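(* Let $u\in\mathcal{K}$, with $E\subset(-\infty,0]$ the corresponding closed set. Then $u$ has the following properties. (a) Monotonicity properties: for all $r>0$, $u(re^{i\theta})$ is decreasing as a function of $\theta$, for $0\le\theta\le\pi$, so, in particular, $B(r,u)=u(r)$ and $A(r,u)=u(-r)$ for all $r>0$. Also, \[ \frac{u(r)}{r^{1/2}}=\frac{B(r,u)}{r^{1/2}}\quad\text{is decreasing for } r>0, \] so, in particular, $\rho(u)\le 1/2$. (b) Bounds for order and lower order: \[ \rho(u)\ge \tfrac12\,\overline{\Lambda}(E^* )\quad\text{and}\quad \lambda(u)\ge \tfrac12\,\underline{\Lambda}(E^* ), \] where $E^*=\{|x|:x\in E\}$.
   Context: The class $\mathcal{K}$: a subharmonic function $u$ on $\mathbb{C}$ is in $\mathcal{K}$ if $u$ is continuous in $\mathbb{C}$ and positive harmonic in $D=\mathbb{C}\setminus E$, where $E\subset(-\infty,0]$ is a closed set on which $u$ vanishes, and each point of $E$ is regular for the Dirichlet problem in $D$. The set $E$ is called the closed set corresponding to $u$. For a continuous subharmonic function $u$ in $\mathbb{C}$ and $r>0$, \[ A(r,u)=\min_{|z|=r}u(z),\qquad B(r,u)=\max_{|z|=r}u(z), \] and the order and lower order of $u$ are \[ \rho(u)=\limsup_{r\to\infty}\frac{\log B(r,u)}{\log r},\qquad \lambda(u)=\liminf_{r\to\infty}\frac{\log B(r,u)}{\log r}. \] For a (measurable) set $S\subset\mathbb{R}^+$, the upper and lower logarithmic densities of $S$ are \[ \overline{\Lambda}(S)=\limsup_{r\to\infty}\frac{1}{\log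 r}\int_{S\cap(1,r)}\frac{dt}{t},\qquad \underline{\Lambda}(S)=\liminf_{r\to\infty}\frac{1}{\log r}\int_{S\cap(1,r)}\frac{dt}{t}. \] "Decreasing" is understood in the weak sense (non-increasing). *)

theory Defs
  imports "HOL-Analysis.Analysis"
begin

(* p, q are the first partial derivatives of u and a, b, c the second ones
   (xx, xy, yy): u is twice continuously differentiable with zero Laplacian. *)
definition harmonic_on :: "(complex \<Rightarrow> real) \<Rightarrow> complex set \<Rightarrow> bool" where
  "harmonic_on u D \<longleftrightarrow> open D \<and>
     (\<exists>p q a b c.
        continuous_on D a \<and> continuous_on D b \<and> continuous_on D c \<and>
        (\<forall>z\<in>D. (u has_derivative (\<lambda>h. p z * Re h + q z * Im h)) (at z) \<and>
               (p has_derivative (\<lambda>h. a z * Re h + b z * Im h)) (at z) \<and>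
               (q has_derivative (\<lambda>h. b z * Re h + c z * Im h)) (at z) \<and>
               a z + c z = 0))"

(* The integral of an extended real function is the integral of its positive part minus
   that of its negative part; e2ennreal truncates negative values to 0. *)
definition circle_mean :: "(complex \<Rightarrow> ereal) \<Rightarrow> complex \<Rightarrow> real \<Rightarrow> ereal" where
  "circle_mean v z r =
     (enn2ereal (\<integral>\<^sup>+t\<in>{0..2*pi}. e2ennreal (v (z + rcis r t)) \<partial>lborel)
      - enn2ereal (\<integral>\<^sup>+t\<in>{0..2*pi}. e2ennreal (- v (z + rcis r t)) \<partial>lborel))
     / ereal (2 * pi)"

(* Upper semicontinuous, with values in [-\<infinity>, \<infinity>), and satisfying the sub-mean-value
   inequality; the function constantly -\<infinity> is allowed. *)
definition subharmonic_on :: "(complex \<Rightarrow> ereal) \<Rightarrow> complex set \<Rightarrow> bool" where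
  "subharmonic_on v G \<longleftrightarrow> open G \<and>
     (\<forall>z\<in>G. v z < \<infinity> \<and> Limsup (at z) v \<le> v z) \<and>
     (\<forall>z r. 0 < r \<and> cball z r \<subseteq> G \<longrightarrow> v z \<le> circle_mean v z r)"

(* The boundary of D is taken in the extended plane; boundary data consist of a function
   \<phi> on the finite boundary and the value c at infinity. For bounded D the filter
   inf at_infinity (principal D) is trivial, and the condition at infinity is void. *)
definition perron_family :: "complex set \<Rightarrow> (complex \<Rightarrow> real) \<Rightarrow> real \<Rightarrow> (complex \<Rightarrow> ereal) set" where
  "perron_family D \<phi> c =
     {v. subharmonic_on v D \<and>
         (\<forall>\<zeta>\<in>frontier D. Limsup (at \<zeta> within D) v \<le> ereal (\<phi> \<zeta>)) \<and>
         Limsup (inf at_infinity (principal D)) v \<le> ereal c}"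

definition perron_solution :: "complex set \<Rightarrow> (complex \<Rightarrow> real) \<Rightarrow> real \<Rightarrow> complex \<Rightarrow> ereal" where
  "perron_solution D \<phi> c z = (SUP v\<in>perron_family D \<phi> c. v z)"

(* The Perron solution attains, at \<zeta>, all boundary data continuous on the boundary
   in the extended plane. *)
definition dirichlet_regular :: "complex set \<Rightarrow> complex \<Rightarrow> bool" where
  "dirichlet_regular D \<zeta> \<longleftrightarrow> \<zeta> \<in> frontier D \<and>
     (\<forall>\<phi> c. continuous_on (frontier D) \<phi> \<and>
            (\<phi> \<longlongrightarrow> c) (inf at_infinity (principal (frontier D))) \<longrightarrow>
            (perron_solution D \<phi> c \<longlongrightarrow> ereal (\<phi> \<zeta>)) (at \<zeta> within D))"

(* u belongs to the class K, and E is the closed set corresponding to u. *)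
definition class_K :: "(complex \<Rightarrow> real) \<Rightarrow> complex set \<Rightarrow> bool" where
  "class_K u E \<longleftrightarrow>
     continuous_on UNIV u \<and> subharmonic_on (\<lambda>z. ereal (u z)) UNIV \<and>
     closed E \<and> E \<subseteq> \<real>\<^sub>\<le>\<^sub>0 \<and>
     harmonic_on u (- E) \<and> (\<forall>z\<in>- E. 0 < u z) \<and> (\<forall>z\<in>E. u z = 0) \<and>
     (\<forall>\<zeta>\<in>E. dirichlet_regular (- E) \<zeta>)"

(* For continuous u the infimum and supremum over the circle are attained. *)
definition min_circle :: "real \<Rightarrow> (complex \<Rightarrow> real) \<Rightarrow> real" where
  "min_circle r u = (INF z\<in>sphere 0 r. u z)"

definition max_circle :: "real \<Rightarrow> (complex \<Rightarrow> real) \<Rightarrow> real" where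
  "max_circle r u = (SUP z\<in>sphere 0 r. u z)"

definition growth_order :: "(complex \<Rightarrow> real) \<Rightarrow> ereal" where
  "growth_order u = Limsup at_top (\<lambda>r::real. ereal (ln (max_circle r u) / ln r))"

definition lower_growth_order :: "(complex \<Rightarrow> real) \<Rightarrow> ereal" where
  "lower_growth_order u = Liminf at_top (\<lambda>r::real. ereal (ln (max_circle r u) / ln r))"

definition upper_log_density :: "real set \<Rightarrow> ereal" where
  "upper_log_density S =
     Limsup at_top (\<lambda>r::real. ereal (1 / ln r * (LINT t:S \<inter> {1<..<r}|lborel. 1 / t)))"

definition lower_log_density :: "real set \<Rightarrow> ereal" where
  "lower_log_density S =
     Liminf at_top (\<lambda>r::real. ereal (1 / ln r * (LINT t:S \<inter> {1<..<r}|lborel. 1 / t)))"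

end

theory Submission
  imports Defs "HOL-Complex_Analysis.Complex_Analysis" "HOL-Real_Asymp.Real_Asymp"
begin

text \<open>Let \<open>S\<close> be the plane cut along the negative real axis.  Besides positivity, three properties of
\<open>u\<close> carry the proof: \<open>u\<close> is continuous, it satisfies the mean value inequality everywhere, and on
\<open>S\<close> it is the real part of a holomorphic function \<open>F\<close>.  The zero set \<open>E\<close> enters the
estimates only at the end, as a set of points where \<open>u(-r) = 0\<close>.

\<^bold>\<open>Growth.\<close>  The map \<open>w \<mapsto> w\<^sup>2\<close> takes the right half plane to \<open>S\<close>, so \<open>u(w\<^sup>2)\<close> is there the real
part of a holomorphic function with values in the right half plane.  The Schwarz lemma gives the
sharp Harnack inequality (\<open>half_plane_Harnack\<close>).  Between two points of the positive axis it says
that \<open>u(r) / r^(1/2)\<close> decreases (\<open>antimono_ratio\<close>); off the axis it bounds \<open>u\<close>, with a constant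
that blows up at the cut.  A barrier and the maximum principle remove the blow-up and give
\<open>max {u z : |z| = r} \<le> 32 u(2r)\<close> (\<open>growth_doubling\<close>), which is \<open>O(r^(1/2))\<close>.

\<^bold>\<open>Monotonicity in the angle.\<close>  Two points \<open>a, b\<close> with \<open>|a| = |b|\<close> and \<open>Re a < Re b\<close> are mirror
images in a line through \<open>0\<close>, with \<open>a\<close> on the side of the cut.  On that side the reflected function
is harmonic, \<open>u\<close> is subharmonic, and the two agree on the line.  Since \<open>u\<close> grows more slowly than
\<open>|z|^(3/4)\<close>, a Phragmen-Lindelof argument gives that \<open>u\<close> is at most its reflection, so \<open>u a \<le> u b\<close>
(\<open>reflection\<close>, \<open>circle_mono\<close>).  This yields at once the symmetry of \<open>u\<close> in the real axis, the decrease in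
the angle, and the identification of the maximum and the minimum on each circle.

\<^bold>\<open>Logarithmic density.\<close>  Put \<open>y(t) = \<integral> u(e\<^sup>t e\<^sup>i\<^sup>\<theta>) cos(\<theta>/2) d\<theta>\<close> over \<open>[-\<pi>, \<pi>]\<close>.  Separation of variables in
Laplace's equation gives \<open>y'' = y/4 - u(-e\<^sup>t)\<close>; hence \<open>z = y' + y/2\<close> satisfies
\<open>z' = z/2 - u(-e\<^sup>t)\<close>.  Thus \<open>z' = z/2\<close> when \<open>e\<^sup>t \<in> E\<^sup>*\<close>.  Also, \<open>u(-e\<^sup>t)\<close> is the minimum of
\<open>u\<close> on its circle, so \<open>y \<ge> 4 u(-e\<^sup>t)\<close>; and \<open>y\<close> is convex and bounded at \<open>-\<infinity>\<close>, so \<open>y' \<ge> 0\<close>.  Hence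
\<open>z \<ge> 2 u(-e\<^sup>t)\<close> and \<open>z' \<ge> 0\<close> everywhere.  So \<open>ln z\<close> increases at rate \<open>1/2\<close> along \<open>ln E\<^sup>*\<close> and never
decreases, while \<open>z(ln r)\<close> is at most a constant times \<open>u(r)\<close>.  This is
\<open>ln u(r) \<ge> 1/2 \<integral> dt/t - const\<close> with the integral over \<open>E\<^sup>* \<inter> (1,r)\<close> (\<open>log_growth\<close>), from which both density
bounds follow.  As \<open>u\<close> need not be differentiable at the cut, the computation is made with
\<open>cos(\<beta> \<theta>)\<close> on a slightly smaller sector, \<open>\<beta> > 1/2\<close>, and \<open>\<beta>\<close> then tends to \<open>1/2\<close>.\<close>

section \<open>The maximum principle\<close>

lemma holomorphic_circle_mean:
  fixes f :: "complex \<Rightarrow> complex"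
  assumes "f holomorphic_on S" "cball z r \<subseteq> S" "0 < r" "open S"
  shows "((\<lambda>t. f (z + rcis r t)) has_integral 2 * pi * f z) {0..2 * pi}"
proof -
  have "((\<lambda>w. f w / (w - z)) has_contour_integral 2 * of_real pi * \<i> * f z) (circlepath z r)"
    using assms by (intro Cauchy_integral_circlepath_simple)
      (auto intro: holomorphic_on_subset)
  then have "((\<lambda>x. f (circlepath z r x) / (circlepath z r x - z) * 
      (2 * pi * \<i> * r * exp (2 * of_real pi * \<i> * x))) has_integral 2 * of_real pi * \<i> * f z) {0..1}"
    unfolding has_contour_integral vector_derivative_circlepath by (simp add: mult_ac)
  then have "((\<lambda>x. (2 * pi * \<i>) * f (z + rcis r (2 * pi * x))) has_integral (2 * pi * \<i>) * f z) {0..1}"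
    by (rule has_integral_eq_rhs[OF has_integral_eq, rotated])
       (use assms in \<open>auto simp: circlepath rcis_def cis_conv_exp algebra_simps\<close>)
  then have "((\<lambda>x. f (z + rcis r (2 * pi * x))) has_integral f z) {0..1}"
    using has_integral_mult_right[of "\<lambda>x. (2 * pi * \<i>) * f (z + rcis r (2 * pi * x))" "(2 * pi * \<i>) * f z" "{0..1}" "1 / (2 * pi * \<i>)"]
    by simp
  from has_integral_stretch_real[OF this, of "1 / (2 * pi)"]
  show ?thesis
    using image_mult_atLeastAtMost[of "2 * pi" 0 1]
    by (simp add: scaleR_conv_of_real mult.commute[of _ "2 * pi"])
qed

text \<open>Among the points of \<open>K\<close> where \<open>u - h\<close> is largest, one with greatest real part cannot be interior:
equality in the mean value inequality would make the rightmost point of a small circle around it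
another such point.\<close>

lemma subharmonic_le_harmonic:
  fixes u h :: "complex \<Rightarrow> real"
  assumes contu: "continuous_on UNIV u"
    and sub_mean: "\<And>z r. 0 < r \<Longrightarrow> 2 * pi * u z \<le> integral {0..2 * pi} (\<lambda>t. u (z + rcis r t))"
    and K: "compact K" and conth: "continuous_on K h"
    and holF: "F holomorphic_on interior K" and ReF: "\<And>z. z \<in> interior K \<Longrightarrow> h z = Re (F z)"
    and bd: "\<And>z. z \<in> K - interior K \<Longrightarrow> u z \<le> h z"
    and z: "z \<in> K"
  shows "u z \<le> h z"
proof (rule ccontr)
  assume neg: "\<not> u z \<le> h z"
  define g where "g = (\<lambda>z. u z - h z)"
  have contg: "continuous_on K g"
    unfolding g_def using contu conth by (intro continuous_intros) (auto intro: continuous_on_subset)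
  obtain b where b: "b \<in> K" "\<And>y. y \<in> K \<Longrightarrow> g y \<le> g b"
    using continuous_attains_sup[OF K _ contg] z by blast
  have gb: "0 < g b" using b(2)[OF z] neg by (simp add: g_def)
  define M where "M = {y \<in> K. g y = g b}"
  have "closed M"
    unfolding M_def using continuous_closed_preimage_constant[OF contg compact_imp_closed[OF K]] by simp
  then have "compact M"
    using K by (metis (no_types, lifting) M_def compact_Int_closed inf.absorb_iff2 mem_Collect_eq subsetI)
  then obtain a where a: "a \<in> M" "\<And>y. y \<in> M \<Longrightarrow> Re y \<le> Re a"
    using continuous_attains_sup[of M Re] b continuous_on_Re[OF continuous_on_id, of M] by (auto simp: M_def)
  have aK: "a \<in> K" "g a = g b" using a by (auto simp: M_def)
  have "a \<in> interior K"
    using bd[of a] aK gb by (force simp: g_def)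
  then obtain r where r: "r > 0" "cball a r \<subseteq> interior K"
    by (metis open_contains_cball open_interior)
  have circ: "a + rcis r t \<in> interior K" for t
    using r by (auto simp: dist_norm intro!: subsetD[OF r(2)])
  have circK: "a + rcis r t \<in> K" for t
    using circ interior_subset by blast
  have contrcis: "continuous_on A (\<lambda>t. a + rcis r t)" for A
    by (auto simp: rcis_def intro!: continuous_intros)
  have conth': "continuous_on {0..2*pi} (\<lambda>t. h (a + rcis r t))"
    using continuous_on_compose2[OF conth contrcis] circK by blast
  have contu': "continuous_on {0..2*pi} (\<lambda>t. u (a + rcis r t))"
    using continuous_on_compose2[OF contu contrcis] by blast
  have "((\<lambda>t. Re (F (a + rcis r t))) has_integral Re (2 * pi * F a)) {0..2 * pi}"
    using holomorphic_circle_mean[OF holF r(2,1)] by (intro has_integral_Re) auto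
  then have hm: "integral {0..2*pi} (\<lambda>t. h (a + rcis r t)) = 2 * pi * h a"
    using ReF[OF circ] ReF[OF \<open>a \<in> interior K\<close>] by (auto simp: integral_unique)
  let ?d = "\<lambda>t. g a - g (a + rcis r t)"
  have d: "?d t \<ge> 0" for t
    using b(2)[OF circK] aK by simp
  have contd: "continuous_on {0..2*pi} ?d"
    unfolding g_def by (intro continuous_intros conth' contu')
  have hi: "((\<lambda>t. h (a + rcis r t)) has_integral 2 * pi * h a) {0..2*pi}"
    and ui: "((\<lambda>t. u (a + rcis r t)) has_integral integral {0..2*pi} (\<lambda>t. u (a + rcis r t))) {0..2*pi}"
    using integrable_integral[OF integrable_continuous_real[OF conth']] hm
      integrable_integral[OF integrable_continuous_real[OF contu']] by auto
  have ci: "((\<lambda>t. g a) has_integral 2 * pi * g a) {0..2*pi}"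
    using has_integral_const_real[of "g a" 0 "2*pi"] by simp
  have "integral {0..2*pi} ?d = 2 * pi * g a - (integral {0..2*pi} (\<lambda>t. u (a + rcis r t)) - 2 * pi * h a)"
    using has_integral_diff[OF ci has_integral_diff[OF ui hi]] by (simp add: g_def integral_unique)
  also have "\<dots> \<le> 0"
    using sub_mean[OF r(1), of a] by (simp add: g_def algebra_simps)
  finally have "integral {0..2*pi} ?d = 0"
    using integral_nonneg[OF integrable_continuous_real[OF contd]] d by force
  then have "?d 0 = 0"
    using integral_eq_0_iff[OF contd] d by (auto dest!: bspec[of _ _ 0])
  then have "a + rcis r 0 \<in> M"
    using aK circK[of 0] by (simp add: M_def)
  then show False
    using a(2)[of "a + rcis r 0"] r by simp
qed

section \<open>Functions of the class in the cut plane\<close>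

text \<open>The set \<open>E\<close> is absent: off the cut \<open>u\<close> is positive and harmonic whatever \<open>E\<close> is, and across the cut the
maximum principle uses only the mean value inequality.\<close>

locale slit_subharmonic =
  fixes u :: "complex \<Rightarrow> real" and F :: "complex \<Rightarrow> complex"
  assumes continuous: "continuous_on UNIV u"
    and nonneg: "0 \<le> u z"
    and sub_mean: "0 < r \<Longrightarrow> 2 * pi * u z \<le> integral {0..2 * pi} (\<lambda>t. u (z + rcis r t))"
    and holomorphic: "F holomorphic_on - \<real>\<^sub>\<le>\<^sub>0"
    and Re_F: "z \<notin> \<real>\<^sub>\<le>\<^sub>0 \<Longrightarrow> Re (F z) = u z"
    and pos: "z \<notin> \<real>\<^sub>\<le>\<^sub>0 \<Longrightarrow> 0 < u z"

lemma circle_mean_nonneg: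
  assumes "continuous_on UNIV u" "\<And>z. 0 \<le> u z"
  shows "circle_mean (\<lambda>z. ereal (u z)) z r = ereal (integral {0..2*pi} (\<lambda>t. u (z + rcis r t)) / (2 * pi))"
proof -
  let ?f = "\<lambda>t. u (z + rcis r t)"
  have cont: "continuous_on UNIV ?f"
    by (rule continuous_on_compose2[OF assms(1)]) (auto simp: rcis_def intro!: continuous_intros)
  have "(?f has_integral integral {0..2*pi} ?f) {0..2*pi}"
    by (intro integrable_integral integrable_continuous_real continuous_on_subset[OF cont]) auto
  from nn_integral_has_integral_lebesgue[OF _ this]
  have "(\<integral>\<^sup>+t\<in>{0..2*pi}. e2ennreal (ereal (?f t)) \<partial>lborel) = ennreal (integral {0..2*pi} ?f)"
    using assms(2) by (simp add: nn_integral_set_ennreal mult.commute)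
  moreover have "(\<integral>\<^sup>+t\<in>{0..2*pi}. e2ennreal (- ereal (?f t)) \<partial>lborel) = 0"
    using assms(2) by (simp add: ennreal_neg)
  moreover have "0 \<le> integral {0..2*pi} ?f"
    using assms(2) by (intro integral_nonneg integrable_continuous_real continuous_on_subset[OF cont]) auto
  ultimately show ?thesis
    by (simp add: circle_mean_def enn2ereal_ennreal zero_ennreal.rep_eq)
qed

text \<open>The complex gradient \<open>p - \<i> q\<close> of a harmonic function satisfies the Cauchy-Riemann equations, so
on a starlike set it has a primitive; the real part of the primitive has the same gradient as \<open>u\<close>.\<close>

lemma harmonic_on_starlike_eq_Re:
  assumes "harmonic_on u D" and S: "open S" "starlike S" "S \<subseteq> D"
  obtains F where "F holomorphic_on S" "\<And>z. z \<in> S \<Longrightarrow> Re (F z) = u z"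
proof -
  obtain p q a b c where
    u': "\<And>z. z \<in> D \<Longrightarrow> (u has_derivative (\<lambda>h. p z * Re h + q z * Im h)) (at z)"
    and p': "\<And>z. z \<in> D \<Longrightarrow> (p has_derivative (\<lambda>h. a z * Re h + b z * Im h)) (at z)"
    and q': "\<And>z. z \<in> D \<Longrightarrow> (q has_derivative (\<lambda>h. b z * Re h + c z * Im h)) (at z)"
    and lap: "\<And>z. z \<in> D \<Longrightarrow> a z + c z = 0"
    using assms(1) unfolding harmonic_on_def by blast
  define g where "g = (\<lambda>z. of_real (p z) - \<i> * of_real (q z))"
  have g': "(g has_field_derivative of_real (a z) - \<i> * of_real (b z)) (at z)" if "z \<in> D" for z
  proof -
    have cz: "c z = - a z" using lap[OF that] by linarith
    have "(g has_derivative (\<lambda>h. of_real (a z * Re h + b z * Im h) - \<i> * of_real (b z * Re h + c z * Im h))) (at z)"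
      unfolding g_def using p'[OF that] q'[OF that]
      by (intro has_derivative_diff has_derivative_of_real has_derivative_mult_right)
    moreover have "(\<lambda>h. of_real (a z * Re h + b z * Im h) - \<i> * of_real (b z * Re h + c z * Im h))
      = (*) (of_real (a z) - \<i> * of_real (b z))"
      using cz by (auto simp: complex_eq_iff algebra_simps fun_eq_iff)
    ultimately show ?thesis
      by (simp add: has_field_derivative_def)
  qed
  then have fd: "g field_differentiable at z" if "z \<in> S" for z
    using that S by (auto simp: field_differentiable_def)
  have "\<exists>G. \<forall>z\<in>S. (G has_field_derivative g z) (at z)"
    using fd S by (intro holomorphic_starlike_primitive[of S g "{}"])
      (auto intro!: continuous_at_imp_continuous_on field_differentiable_imp_continuous_at)
  then obtain G where G: "\<And>z. z \<in> S \<Longrightarrow> (G has_field_derivative g z) (at z)" by blast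
  have "((\<lambda>z. Re (G z) - u z) has_derivative (\<lambda>h. 0)) (at z)" if "z \<in> S" for z
  proof -
    have "((\<lambda>z. Re (G z) - u z) has_derivative (\<lambda>h. Re (g z * h) - (p z * Re h + q z * Im h))) (at z)"
      using G[OF that] u'[of z] that S
      by (intro has_derivative_diff has_derivative_Re) (auto simp: has_field_derivative_def)
    then show ?thesis
      by (simp add: g_def algebra_simps)
  qed
  moreover have "connected S"
    using S starlike_imp_connected by blast
  ultimately have const: "Re (G z) - u z = Re (G w) - u w" if "z \<in> S" "w \<in> S" for z w
    using has_derivative_zero_unique_connected[OF S(1), of "\<lambda>z. Re (G z) - u z"] that by blast
  define k where "k = Re (G (SOME w. w \<in> S)) - u (SOME w. w \<in> S)"
  have k: "Re (G z) - u z = k" if "z \<in> S" for z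
    unfolding k_def using that by (intro const) (auto intro: someI)
  show thesis
  proof
    show "(\<lambda>z. G z - of_real k) holomorphic_on S"
      using G S by (intro holomorphic_intros) (auto simp: holomorphic_on_open)
    show "Re (G z - of_real k) = u z" if "z \<in> S" for z
      using k[OF that] by simp
  qed
qed

lemma class_K_slit_subharmonic:
  assumes "class_K u E"
  obtains F where "slit_subharmonic u F"
proof -
  have cont: "continuous_on UNIV u" and sub: "subharmonic_on (\<lambda>z. ereal (u z)) UNIV"
    and E: "E \<subseteq> \<real>\<^sub>\<le>\<^sub>0" and harm: "harmonic_on u (- E)"
    and pos: "\<And>z. z \<notin> E \<Longrightarrow> 0 < u z" and zero: "\<And>z. z \<in> E \<Longrightarrow> u z = 0"
    using assms unfolding class_K_def by auto
  have nonneg: "0 \<le> u z" for z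
    using pos[of z] zero[of z] by (cases "z \<in> E") auto
  have pos': "0 < u z" if "z \<notin> \<real>\<^sub>\<le>\<^sub>0" for z
    using that pos E by blast
  have "starlike (- \<real>\<^sub>\<le>\<^sub>0 :: complex set)"
  proof -
    have "(\<real>\<^sub>\<le>\<^sub>0 :: complex set) = of_real ` {..0}"
      by (auto simp: complex_nonpos_Reals_iff complex_slot_left_eq)
    then show ?thesis
      using starlike_slotted_complex_plane_left[of 0] by simp
  qed
  then obtain F where "F holomorphic_on - \<real>\<^sub>\<le>\<^sub>0" "\<And>z. z \<in> - \<real>\<^sub>\<le>\<^sub>0 \<Longrightarrow> Re (F z) = u z"
    using harmonic_on_starlike_eq_Re[OF harm, of "- \<real>\<^sub>\<le>\<^sub>0"] E by (auto simp: open_Compl)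
  moreover have "2 * pi * u z \<le> integral {0..2*pi} (\<lambda>t. u (z + rcis r t))" if "0 < r" for z r
  proof -
    have "ereal (u z) \<le> circle_mean (\<lambda>z. ereal (u z)) z r"
      using sub that unfolding subharmonic_on_def by auto
    then show ?thesis
      by (simp add: circle_mean_nonneg[OF cont nonneg] field_simps)
  qed
  ultimately show thesis
    using cont nonneg pos' by (intro that[of F] slit_subharmonic.intro) auto
qed

section \<open>Harnack inequalities from the Schwarz lemma\<close>

text \<open>The Schwarz lemma, applied to the map of the disc into itself that is conjugate to \<open>G\<close> under Cayley
transforms sending the centre to \<open>x\<close> and \<open>G x\<close>.  The constant is sharp, as \<open>G w = w\<close> shows on the
real axis; that sharpness is what produces the exact exponent \<open>1/2\<close>.\<close>

lemma half_plane_Harnack: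
  assumes holG: "G holomorphic_on {w. 0 < Re w}" and posG: "\<And>w. 0 < Re w \<Longrightarrow> 0 < Re (G w)"
    and x: "0 < x" and w: "0 < Re w"
  shows "(cmod (w + of_real x) - cmod (w - of_real x)) * Re (G w)
    \<le> (cmod (w + of_real x) + cmod (w - of_real x)) * Re (G (of_real x))"
proof -
  define C where "C = (\<lambda>\<zeta>::complex. of_real x * (1 + \<zeta>) / (1 - \<zeta>))"
  define b where "b = G (of_real x)"
  define \<phi> where "\<phi> = (\<lambda>\<zeta>. (G (C \<zeta>) - b) / (G (C \<zeta>) + cnj b))"
  have b: "0 < Re b"
    using posG[of "of_real x"] x by (simp add: b_def)
  have one: "1 - \<zeta> \<noteq> 0" if "cmod \<zeta> < 1" for \<zeta>
    using that by auto
  have ReC: "0 < Re (C \<zeta>)" if "cmod \<zeta> < 1" for \<zeta>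
  proof -
    have "Re (C \<zeta>) = x * (1 - (cmod \<zeta>)\<^sup>2) / (cmod (1 - \<zeta>))\<^sup>2"
      unfolding C_def cmod_power2
      by (simp add: Re_divide power2_eq_square field_simps)
    moreover have "(cmod \<zeta>)\<^sup>2 < 1"
      using that by (simp add: abs_square_less_1)
    ultimately show ?thesis
      using x one[OF that] by simp
  qed
  have holC: "C holomorphic_on ball 0 1"
    unfolding C_def using one by (intro holomorphic_intros) auto
  have den: "G (C \<zeta>) + cnj b \<noteq> 0" if "cmod \<zeta> < 1" for \<zeta>
    using posG[OF ReC[OF that]] b by (auto simp: complex_eq_iff)
  have "(G \<circ> C) holomorphic_on ball 0 1"
    using holC by (rule holomorphic_on_compose_gen[OF _ holG]) (use ReC in auto)
  then have hol\<phi>: "\<phi> holomorphic_on ball 0 1"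
    unfolding \<phi>_def using den by (intro holomorphic_intros) (auto simp: o_def)
  have "cmod (\<phi> \<zeta>) < 1" if "cmod \<zeta> < 1" for \<zeta>
  proof -
    have "(cmod (G (C \<zeta>) + cnj b))\<^sup>2 - (cmod (G (C \<zeta>) - b))\<^sup>2 = 4 * (Re (G (C \<zeta>)) * Re b)"
      unfolding cmod_power2 by (simp add: power2_eq_square ring_distribs)
    then have "(cmod (G (C \<zeta>) - b))\<^sup>2 < (cmod (G (C \<zeta>) + cnj b))\<^sup>2"
      using mult_pos_pos[OF posG[OF ReC[OF that]] b] by linarith
    then have "cmod (G (C \<zeta>) - b) < cmod (G (C \<zeta>) + cnj b)"
      by (rule power2_less_imp_less) simp
    then show ?thesis
      using den[OF that] by (simp add: \<phi>_def norm_divide)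
  qed
  note schwarz = Schwarz_Lemma(1)[OF hol\<phi> _ this]
  define \<zeta> where "\<zeta> = (w - of_real x) / (w + of_real x)"
  have wx: "w + of_real x \<noteq> 0"
    using w x by (auto simp: complex_eq_iff)
  have "(cmod (w + of_real x))\<^sup>2 - (cmod (w - of_real x))\<^sup>2 = 4 * (Re w * x)"
    unfolding cmod_power2 by (simp add: power2_eq_square ring_distribs)
  then have "(cmod (w - of_real x))\<^sup>2 < (cmod (w + of_real x))\<^sup>2"
    using mult_pos_pos[OF w x] by linarith
  then have "cmod (w - of_real x) < cmod (w + of_real x)"
    by (rule power2_less_imp_less) simp
  then have \<zeta>: "cmod \<zeta> < 1"
    using wx by (simp add: \<zeta>_def norm_divide)
  have C\<zeta>: "C \<zeta> = w"
  proof -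
    have "1 + \<zeta> = 2 * w / (w + of_real x)" "1 - \<zeta> = 2 * of_real x / (w + of_real x)"
      using wx by (auto simp: \<zeta>_def divide_simps)
    then show ?thesis
      using wx x by (simp add: C_def)
  qed
  have "cmod (\<phi> \<zeta>) \<le> cmod \<zeta>"
    using \<zeta> x by (intro schwarz) (auto simp: \<phi>_def b_def C_def)
  then have *: "cmod (G w - b) \<le> cmod \<zeta> * cmod (G w + cnj b)"
    using den[OF \<zeta>] by (simp add: \<phi>_def C\<zeta> norm_divide divide_simps)
  \<comment> \<open>Dropping the imaginary parts is harmless because \<open>|\<zeta>| < 1\<close>.\<close>
  have "Re (G w) - Re b \<le> cmod \<zeta> * (Re (G w) + Re b)"
  proof (rule power2_le_imp_le)
    have "(cmod (G w - b))\<^sup>2 \<le> (cmod \<zeta> * cmod (G w + cnj b))\<^sup>2"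
      using * by (intro power_mono) auto
    then have "(Re (G w) - Re b)\<^sup>2 + (Im (G w) - Im b)\<^sup>2
        \<le> (cmod \<zeta>)\<^sup>2 * (Re (G w) + Re b)\<^sup>2 + (cmod \<zeta>)\<^sup>2 * (Im (G w) - Im b)\<^sup>2"
      by (simp add: power_mult_distrib cmod_power2[of "G w - b"] cmod_power2[of "G w + cnj b"] distrib_left)
    moreover have "(cmod \<zeta>)\<^sup>2 * (Im (G w) - Im b)\<^sup>2 \<le> 1 * (Im (G w) - Im b)\<^sup>2"
      using \<zeta> by (intro mult_right_mono) (auto simp: abs_square_le_1)
    ultimately show "(Re (G w) - Re b)\<^sup>2 \<le> (cmod \<zeta> * (Re (G w) + Re b))\<^sup>2"
      by (simp add: power_mult_distrib)
    show "0 \<le> cmod \<zeta> * (Re (G w) + Re b)"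
      using posG[OF w] b by simp
  qed
  then have "(Re (G w) - Re b) * cmod (w + of_real x) \<le> cmod (w - of_real x) * (Re (G w) + Re b)"
    using wx by (simp add: \<zeta>_def norm_divide field_simps)
  then show ?thesis
    by (simp add: b_def algebra_simps)
qed

context slit_subharmonic
begin

lemma square_not_nonpos:
  assumes "0 < Re w" shows "w\<^sup>2 \<notin> \<real>\<^sub>\<le>\<^sub>0"
  using assms by (auto simp: complex_nonpos_Reals_iff power2_eq_square complex_eq_iff not_le)

lemma Harnack_square:
  assumes x: "0 < x" and w: "0 < Re w"
  shows "(cmod (w + of_real x) - cmod (w - of_real x)) * u (w\<^sup>2)
    \<le> (cmod (w + of_real x) + cmod (w - of_real x)) * u (of_real (x\<^sup>2))"
proof -
  have "(F \<circ> (\<lambda>w. w\<^sup>2)) holomorphic_on {w. 0 < Re w}"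
    by (rule holomorphic_on_compose_gen[OF _ holomorphic])
       (use square_not_nonpos in \<open>auto intro!: holomorphic_intros\<close>)
  from half_plane_Harnack[OF this _ x w] show ?thesis
    using square_not_nonpos[OF w] square_not_nonpos[of "of_real x"] x
    by (auto simp: Re_F pos square_not_nonpos)
qed

lemma antimono_ratio:
  assumes "0 < r" "r \<le> s"
  shows "u (of_real s) / sqrt s \<le> u (of_real r) / sqrt r"
proof -
  have "(cmod (of_real (sqrt s) + of_real (sqrt r)) - cmod (of_real (sqrt s) - of_real (sqrt r))) * u (of_real s)
    \<le> (cmod (of_real (sqrt s) + of_real (sqrt r)) + cmod (of_real (sqrt s) - of_real (sqrt r))) * u (of_real r)"
    using Harnack_square[of "sqrt r" "of_real (sqrt s)"] assms
    by (simp flip: of_real_power)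
  moreover have "cmod (of_real (sqrt s) + of_real (sqrt r)) = sqrt s + sqrt r"
    using assms by (simp flip: of_real_add)
  moreover have "cmod (of_real (sqrt s) - of_real (sqrt r)) = sqrt s - sqrt r"
    using assms by (simp flip: of_real_diff)
  ultimately show ?thesis
    using assms by (simp add: field_simps)
qed

text \<open>The square root on the left is the real part of the square root of \<open>z\<close>; it vanishes on the cut, so this
bound degenerates there.\<close>

lemma off_axis_bound:
  assumes z: "z \<notin> \<real>\<^sub>\<le>\<^sub>0" and \<rho>: "cmod z \<le> \<rho>"
  shows "sqrt ((cmod z + Re z) / 2) * u z \<le> 4 * sqrt \<rho> * u (of_real \<rho>)"
proof -
  define w x where "w = csqrt z" and "x = sqrt \<rho>"
  have "z \<noteq> 0" using z by auto
  then have "\<rho> > 0" using \<rho> by (meson less_le_trans zero_less_norm_iff)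
  then have x: "0 < x" "x\<^sup>2 = \<rho>" by (auto simp: x_def)
  have w2: "w\<^sup>2 = z" by (simp add: w_def)
  have Rew: "Re w = sqrt ((cmod z + Re z) / 2)" by (simp add: w_def)
  have "- Re z < cmod z"
  proof (rule ccontr)
    assume "\<not> - Re z < cmod z"
    then have "cmod z = - Re z" using abs_Re_le_cmod[of z] by linarith
    then have "(Im z)\<^sup>2 = 0" using cmod_power2[of z] by simp
    with \<open>cmod z = - Re z\<close> z show False
      using norm_ge_zero[of z] by (auto simp: complex_nonpos_Reals_iff)
  qed
  then have w: "0 < Re w" unfolding Rew by simp
  define p q where "p = cmod (w + of_real x)" and "q = cmod (w - of_real x)"
  have pq: "p\<^sup>2 - q\<^sup>2 = 4 * x * Re w"
    unfolding p_def q_def cmod_power2 by (simp add: power2_eq_square algebra_simps)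
  have "cmod w = sqrt (cmod z)"
    by (simp add: w_def)
  then have "cmod w \<le> x" using \<rho> by (simp add: x_def)
  then have pq2: "p \<le> 2 * x" "q \<le> 2 * x" "0 \<le> p" "0 \<le> q"
    using norm_triangle_ineq[of w "of_real x"] norm_triangle_ineq4[of w "of_real x"] x
    by (auto simp: p_def q_def)
  have "(p - q) * u z \<le> (p + q) * u (of_real \<rho>)"
    using Harnack_square[OF x(1) w] by (simp add: p_def q_def w2 x flip: of_real_power)
  then have "(p + q) * ((p - q) * u z) \<le> (p + q) * ((p + q) * u (of_real \<rho>))"
    using pq2 by (intro mult_left_mono) auto
  then have "(p\<^sup>2 - q\<^sup>2) * u z \<le> (p + q)\<^sup>2 * u (of_real \<rho>)"
    by (simp add: power2_eq_square algebra_simps)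
  also have "\<dots> \<le> (4 * x)\<^sup>2 * u (of_real \<rho>)"
    using pq2 by (intro mult_right_mono power_mono nonneg) auto
  finally have "(4 * x) * (Re w * u z) \<le> (4 * x) * (4 * x * u (of_real \<rho>))"
    unfolding pq by (simp add: power2_eq_square algebra_simps)
  then have "Re w * u z \<le> 4 * x * u (of_real \<rho>)"
    using x mult_le_cancel_left_pos[of "4 * x"] by simp
  then show ?thesis
    by (simp only: Rew x_def)
qed

end

section \<open>Boundedness up to the cut\<close>

lemma compact_corner: "compact {z. cmod z \<le> \<rho> \<and> \<bar>Im z\<bar> \<le> Re z + \<rho> \<and> \<delta> \<le> cmod (z + of_real \<rho>)}"
proof -
  have "closed {z. cmod z \<le> \<rho> \<and> \<bar>Im z\<bar> \<le> Re z + \<rho> \<and> \<delta> \<le> cmod (z + of_real \<rho>)}"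
    by (intro closed_Collect_conj closed_Collect_le continuous_intros)
  moreover have "bounded {z. cmod z \<le> \<rho> \<and> \<bar>Im z\<bar> \<le> Re z + \<rho> \<and> \<delta> \<le> cmod (z + of_real \<rho>)}"
    by (auto simp: bounded_iff)
  ultimately show ?thesis
    by (simp add: compact_eq_bounded_closed)
qed

context slit_subharmonic
begin

text \<open>The region \<open>K\<close> contains the part of the cut between \<open>-\<rho>\<close> and \<open>0\<close>, and its boundary meets the cut
only at the corner \<open>-\<rho>\<close>, under an angle of 45 degrees.  There the bound off the axis grows like the
reciprocal of the distance to \<open>-\<rho>\<close>, and at such an angle so does the harmonic function
\<open>Re (1 / (z + \<rho>))\<close>, which dominates it.  Removing a small disc around the corner leaves a compact set to
which the maximum principle applies, because \<open>u\<close> itself is bounded.\<close>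

lemma growth_doubling:
  assumes \<rho>: "0 < \<rho>" and z: "cmod z \<le> \<rho> / 2"
  shows "u z \<le> 32 * u (of_real \<rho>)"
proof -
  have u\<rho>: "0 < u (of_real \<rho>)"
    using \<rho> by (intro pos) auto
  define c where "c = 16 * \<rho> * u (of_real \<rho>)"
  have c: "0 < c" using \<rho> u\<rho> by (simp add: c_def)
  obtain M where M: "\<And>z. z \<in> cball 0 \<rho> \<Longrightarrow> u z \<le> M"
    using compact_continuous_image[OF continuous_on_subset[OF continuous] compact_cball, of 0 \<rho>]
    by (metis bounded_imp_bdd_above compact_imp_bounded bdd_above.unfold imageI subset_UNIV)
  \<comment> \<open>So small that the barrier, at least \<open>c / (2 \<delta>)\<close> on the circle of radius \<open>\<delta>\<close> around the corner, is at least \<open>M\<close> there.\<close>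
  define \<delta> where "\<delta> = min (\<rho> / 2) (c / (2 * max M 1))"
  have \<delta>: "0 < \<delta>" "\<delta> \<le> \<rho> / 2"
    using \<rho> c by (auto simp: \<delta>_def)
  have "\<delta> \<le> c / (2 * max M 1)" by (simp add: \<delta>_def)
  then have "max M 1 * (2 * \<delta>) \<le> c"
    by (simp add: field_simps)
  then have \<delta>M: "M \<le> c / (2 * \<delta>)"
    using \<delta> by (simp add: pos_le_divide_eq) (smt (verit, best) mult_right_mono)
  define K where "K = {z. cmod z \<le> \<rho> \<and> \<bar>Im z\<bar> \<le> Re z + \<rho> \<and> \<delta> \<le> cmod (z + of_real \<rho>)}"
  define B where "B = (\<lambda>z::complex. of_real c / (z + of_real \<rho>))"
  have ReB: "Re (B z) = c * (Re z + \<rho>) / (cmod (z + of_real \<rho>))\<^sup>2" for z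
    by (simp add: B_def Re_divide cmod_power2)
  have nz: "z + of_real \<rho> \<noteq> 0" if "z \<in> K" for z
    using that \<delta> by (auto simp: K_def)
  have bd: "u z \<le> Re (B z)" if "z \<in> K - interior K" for z
  proof -
    have zK: "cmod z \<le> \<rho>" "\<bar>Im z\<bar> \<le> Re z + \<rho>" "\<delta> \<le> cmod (z + of_real \<rho>)"
      using that by (auto simp: K_def)
    have x\<rho>: "0 < Re z + \<rho>"
      using zK(2) nz[of z] that by (cases "Re z + \<rho> = 0") (auto simp: complex_eq_iff)
    have "open {z. cmod z < \<rho> \<and> \<bar>Im z\<bar> < Re z + \<rho> \<and> \<delta> < cmod (z + of_real \<rho>)}"
      by (intro open_Collect_conj open_Collect_less continuous_intros)
    then have "{z. cmod z < \<rho> \<and> \<bar>Im z\<bar> < Re z + \<rho> \<and> \<delta> < cmod (z + of_real \<rho>)} \<subseteq> interior K"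
      by (intro interior_maximal) (auto simp: K_def)
    then have "\<not> (cmod z < \<rho> \<and> \<bar>Im z\<bar> < Re z + \<rho> \<and> \<delta> < cmod (z + of_real \<rho>))"
      using that by blast
    with zK consider "cmod (z + of_real \<rho>) = \<delta>" | "\<bar>Im z\<bar> = Re z + \<rho>" | "cmod z = \<rho>"
      by linarith
    then show ?thesis
    proof cases
      case 1
      have "\<delta> \<le> 2 * (Re z + \<rho>)"
        using cmod_le[of "z + of_real \<rho>"] 1 zK x\<rho> by simp
      then have "c * (\<delta> / 2) / \<delta>\<^sup>2 \<le> Re (B z)"
        unfolding ReB 1 using c by (intro divide_right_mono mult_left_mono) auto
      moreover have "c * (\<delta> / 2) / \<delta>\<^sup>2 = c / (2 * \<delta>)"
        using \<delta> by (simp add: power2_eq_square)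
      ultimately show ?thesis
        using M[of z] zK \<delta>M by simp
    next
      case 2
      have "z \<notin> \<real>\<^sub>\<le>\<^sub>0" using 2 x\<rho> by (auto simp: complex_nonpos_Reals_iff)
      note ob = off_axis_bound[OF this zK(1)]
      have "(Im z)\<^sup>2 = (cmod z + Re z) * (cmod z - Re z)"
        using cmod_power2[of z] by (simp add: power2_eq_square algebra_simps)
      also have "\<dots> \<le> (cmod z + Re z) * (2 * \<rho>)"
        using zK(1) abs_Re_le_cmod[of z] by (intro mult_left_mono) auto
      finally have "(\<bar>Im z\<bar> / (2 * sqrt \<rho>))\<^sup>2 \<le> (cmod z + Re z) / 2"
        using \<rho> by (simp add: power_divide power_mult_distrib field_simps)
      then have "\<bar>Im z\<bar> / (2 * sqrt \<rho>) \<le> sqrt ((cmod z + Re z) / 2)"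
        by (rule real_le_rsqrt)
      then have "\<bar>Im z\<bar> / (2 * sqrt \<rho>) * u z \<le> 4 * sqrt \<rho> * u (of_real \<rho>)"
        using ob nonneg[of z] by (meson mult_right_mono order_trans)
      then have "\<bar>Im z\<bar> * u z \<le> 8 * \<rho> * u (of_real \<rho>)"
        using \<rho> by (simp add: field_simps flip: mult.assoc[of "sqrt \<rho>" "sqrt \<rho>"])
      moreover have "(cmod (z + of_real \<rho>))\<^sup>2 = 2 * (Re z + \<rho>)\<^sup>2"
        using arg_cong[OF 2, of "\<lambda>x. x\<^sup>2"] by (simp add: cmod_power2)
      then have "Re (B z) = c / (2 * \<bar>Im z\<bar>)"
        unfolding ReB 2 using x\<rho> by (simp add: power2_eq_square)
      moreover have "0 < \<bar>Im z\<bar>" using 2 x\<rho> by simp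
      ultimately show ?thesis
        by (simp add: c_def pos_le_divide_eq mult_ac)
    next
      case 3
      have "(Im z)\<^sup>2 \<le> (Re z + \<rho>)\<^sup>2"
        using power_mono[OF zK(2), of 2] by simp
      then have "\<rho>\<^sup>2 - (Re z)\<^sup>2 \<le> (Re z + \<rho>)\<^sup>2"
        using cmod_power2[of z] 3 by simp
      then have "(Re z + \<rho>) * (\<rho> - Re z) \<le> (Re z + \<rho>) * (Re z + \<rho>)"
        by (simp add: power2_eq_square algebra_simps)
      then have x: "0 \<le> Re z" using x\<rho> by simp
      then have "z \<notin> \<real>\<^sub>\<le>\<^sub>0" using 3 \<rho> by (auto simp: complex_nonpos_Reals_iff cmod_eq_Re)
      note ob = off_axis_bound[OF this zK(1)]
      have "(sqrt \<rho> / 2)\<^sup>2 \<le> (cmod z + Re z) / 2"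
        using x \<rho> 3 by (simp add: power_divide)
      then have "sqrt \<rho> / 2 \<le> sqrt ((cmod z + Re z) / 2)"
        by (rule real_le_rsqrt)
      then have "sqrt \<rho> / 2 * u z \<le> 4 * sqrt \<rho> * u (of_real \<rho>)"
        using ob nonneg[of z] by (meson mult_right_mono order_trans)
      then have "u z \<le> 8 * u (of_real \<rho>)"
        using \<rho> by simp
      moreover have "(cmod (z + of_real \<rho>))\<^sup>2 = 2 * \<rho> * (Re z + \<rho>)"
        using cmod_power2[of z] unfolding cmod_power2[of "z + of_real \<rho>"] 3
        by (simp add: power2_eq_square algebra_simps)
      then have "Re (B z) = 8 * u (of_real \<rho>)"
        unfolding ReB using x\<rho> \<rho> by (simp add: c_def)
      ultimately show ?thesis by simp
    qed
  qed
  have zK: "z \<in> K"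
    using z \<delta> abs_Re_le_cmod[of z] abs_Im_le_cmod[of z] norm_diff_ineq[of "of_real \<rho>" z] \<rho>
    by (auto simp: K_def add.commute)
  have holB: "B holomorphic_on K"
    unfolding B_def using nz by (intro holomorphic_intros) auto
  have "u z \<le> Re (B z)"
  proof (rule subharmonic_le_harmonic[where F = B and K = K and u = u and h = "\<lambda>z. Re (B z)"])
    show "compact K" unfolding K_def by (rule compact_corner)
    show "continuous_on K (\<lambda>z. Re (B z))"
      using holB by (intro continuous_intros holomorphic_on_imp_continuous_on)
    show "B holomorphic_on interior K"
      using holB interior_subset by (rule holomorphic_on_subset)
  qed (use bd zK continuous sub_mean in auto)
  also have "\<dots> \<le> cmod (B z)" by (rule complex_Re_le_cmod)
  also have "\<dots> \<le> c / (\<rho> / 2)"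
    using norm_diff_ineq[of "of_real \<rho>" z] z \<rho> c
    unfolding B_def norm_divide by (intro frac_le) (auto simp: add.commute)
  finally show ?thesis using \<rho> by (simp add: c_def)
qed

lemma growth_bound:
  assumes "1/2 \<le> R" "cmod z = R"
  shows "u z \<le> 32 * sqrt (2 * R) * u 1"
proof -
  have "u z \<le> 32 * u (of_real (2 * R))"
    using assms by (intro growth_doubling) auto
  also have "u (of_real (2 * R)) \<le> sqrt (2 * R) * u 1"
    using antimono_ratio[of 1 "2 * R"] assms by (simp add: field_simps)
  finally show ?thesis by simp
qed

end

section \<open>Reflection in lines through the origin\<close>

lemma interior_half_disc:
  assumes n: "cmod n = 1"
  shows "interior {a. cmod a \<le> R \<and> 0 \<le> Re (a * cnj n)} \<subseteq> {a. 0 < Re (a * cnj n)}"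
proof safe
  fix a assume "a \<in> interior {a. cmod a \<le> R \<and> 0 \<le> Re (a * cnj n)}"
  then obtain e where e: "e > 0" "cball a e \<subseteq> {a. cmod a \<le> R \<and> 0 \<le> Re (a * cnj n)}"
    by (meson mem_interior_cball)
  have "a - of_real e * n \<in> cball a e"
    using n e by (simp add: dist_norm norm_mult)
  with e have "0 \<le> Re ((a - of_real e * n) * cnj n)" by blast
  also have "(a - of_real e * n) * cnj n = a * cnj n - of_real e"
    using n by (simp add: left_diff_distrib mult.assoc complex_norm_square[symmetric])
  finally show "0 < Re (a * cnj n)" using e by simp
qed

text \<open>A harmonic comparison function on the right half plane: the exponent lies strictly between
\<open>1/2\<close>, the growth of \<open>u\<close>, and \<open>1\<close>, beyond which the real part would change sign.  The shift by
\<open>1\<close> keeps it holomorphic on the boundary line.\<close>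

lemma Re_powr_three_quarters:
  assumes w: "0 \<le> Re w"
  shows "cos (3 * pi / 8) * cmod w powr (3/4) \<le> Re ((w + 1) powr (3/4))"
proof -
  have w1: "0 < Re (w + 1)" "w + 1 \<noteq> 0" using w by (auto simp: complex_eq_iff)
  have "\<bar>Im (Ln (w + 1))\<bar> < pi / 2"
    using Re_Ln_pos_lt_imp w1 by blast
  then have "cos (3 * pi / 8) \<le> cos \<bar>3 / 4 * Im (Ln (w + 1))\<bar>"
    by (intro cos_monotone_0_pi_le) (auto simp: abs_mult)
  then have a: "cos (3 * pi / 8) \<le> cos (3 / 4 * Im (Ln (w + 1)))"
    unfolding cos_abs_real .
  have "(cmod w)\<^sup>2 \<le> (cmod (w + 1))\<^sup>2"
    unfolding cmod_power2 using w by (simp add: power2_eq_square algebra_simps)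
  then have "cmod w \<le> cmod (w + 1)"
    by (rule power2_le_imp_le) simp
  then have b: "cmod w powr (3/4) \<le> cmod (w + 1) powr (3/4)"
    by (intro powr_mono2) auto
  have c: "cmod (w + 1) powr (3/4) = exp (3 / 4 * Re (Ln (w + 1)))"
    using w1 by (simp add: powr_def)
  have "cos (3 * pi / 8) * cmod w powr (3/4) \<le> cos (3 / 4 * Im (Ln (w + 1))) * cmod (w + 1) powr (3/4)"
    using a b cos_gt_zero_pi[of "3 * pi / 8"] by (intro mult_mono) (auto intro: order_trans[OF _ a])
  also have "\<dots> = Re ((w + 1) powr (3/4))"
    using w1 unfolding c by (simp add: powr_def Re_exp)
  finally show ?thesis .
qed

context slit_subharmonic
begin

text \<open>Here \<open>n\<close> is a unit normal of the line and \<open>- n\<^sup>2 cnj z\<close> is the mirror image of \<open>z\<close>.  The condition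
\<open>Re n < 0\<close> puts the cut on the side of \<open>z\<close>, so that the mirror images of points on this side avoid the
cut and the reflected function is harmonic.\<close>

lemma reflection:
  assumes n: "cmod n = 1" "Re n < 0" and z: "0 \<le> Re (z * cnj n)"
  shows "u z \<le> u (- (n\<^sup>2) * cnj z)"
proof -
  define \<sigma> where "\<sigma> = (\<lambda>a. - (n\<^sup>2) * cnj a)"
  have nn: "n * cnj n = 1" using n by (simp add: complex_norm_square[symmetric])
  have norm\<sigma>: "cmod (\<sigma> a) = cmod a" for a
    using n by (simp add: \<sigma>_def norm_mult norm_power)
  have \<sigma>_eq: "\<sigma> a = - n * cnj (a * cnj n)" for a
    by (simp add: \<sigma>_def power2_eq_square)
  have fix\<sigma>: "\<sigma> a = a" if "Re (a * cnj n) = 0" for a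
  proof -
    have "cnj (a * cnj n) = - (a * cnj n)" using that by (simp add: complex_eq_iff)
    then show ?thesis unfolding \<sigma>_eq using nn by (simp add: algebra_simps)
  qed
  have slit: "\<sigma> a \<notin> \<real>\<^sub>\<le>\<^sub>0" if "0 < Re (a * cnj n)" for a
  proof
    assume "\<sigma> a \<in> \<real>\<^sub>\<le>\<^sub>0"
    then obtain x where x: "\<sigma> a = of_real x" "x \<le> 0" by (elim nonpos_Reals_cases)
    have "\<sigma> a * cnj n = - cnj (a * cnj n) * (n * cnj n)"
      unfolding \<sigma>_eq by (simp add: algebra_simps)
    also have "\<dots> = - cnj (a * cnj n)"
      using nn by simp
    finally have "Re (\<sigma> a * cnj n) = - Re (a * cnj n)"
      by simp
    moreover have "Re (\<sigma> a * cnj n) = x * Re n" by (simp add: x)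
    moreover have "0 \<le> x * Re n" using x n by (simp add: mult_nonpos_nonpos)
    ultimately show False using that by simp
  qed
  have hol: "(cnj \<circ> (\<lambda>b. F (- (n\<^sup>2) * b)) \<circ> cnj) holomorphic_on {a. 0 < Re (a * cnj n)}"
  proof (rule holomorphic_on_compose_cnj_cnj)
    have "(F \<circ> (\<lambda>b. - (n\<^sup>2) * b)) holomorphic_on cnj ` {a. 0 < Re (a * cnj n)}"
      by (rule holomorphic_on_compose_gen[OF _ holomorphic])
         (use slit in \<open>auto simp: \<sigma>_def intro!: holomorphic_intros\<close>)
    then show "(\<lambda>b. F (- (n\<^sup>2) * b)) holomorphic_on cnj ` {a. 0 < Re (a * cnj n)}"
      by (simp add: o_def)
    show "open {a. 0 < Re (a * cnj n)}"
      by (intro open_Collect_less continuous_intros)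
  qed
  define \<gamma> where "\<gamma> = cos (3 * pi / 8)"
  have \<gamma>: "0 < \<gamma>" unfolding \<gamma>_def by (intro cos_gt_zero) auto
  define p where "p = (\<lambda>a. (a * cnj n + 1) powr (3/4))"
  have p: "\<gamma> * cmod a powr (3/4) \<le> Re (p a)" if "0 \<le> Re (a * cnj n)" for a
    using Re_powr_three_quarters[OF that] n by (simp add: p_def \<gamma>_def norm_mult)
  have p0: "0 \<le> Re (p a)" if "0 \<le> Re (a * cnj n)" for a
    using p[OF that] \<gamma> by (smt (verit) mult_nonneg_nonneg powr_ge_zero)
  have holp: "p holomorphic_on {a. 0 \<le> Re (a * cnj n)}"
    unfolding p_def by (intro holomorphic_intros) (auto simp: complex_nonpos_Reals_iff)
  have "u z \<le> u (\<sigma> z) + \<epsilon> * Re (p z)" if \<epsilon>: "0 < \<epsilon>" for \<epsilon>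
  proof -
    \<comment> \<open>A radius at which \<open>\<epsilon> Re p\<close>, of order \<open>R^(3/4)\<close>, exceeds the bound \<open>O(R^(1/2))\<close> for \<open>u\<close>; a fourth power keeps the exponents integral.\<close>
    define T where "T = max (max 1 (cmod z)) (32 * sqrt 2 * u 1 / (\<epsilon> * \<gamma>))"
    have T: "1 \<le> T" "cmod z \<le> T" "32 * sqrt 2 * u 1 / (\<epsilon> * \<gamma>) \<le> T"
      by (auto simp: T_def)
    define R where "R = T ^ 4"
    have R: "1 \<le> R" "cmod z \<le> R"
      using T power_increasing[of 1 4 T] by (auto simp: R_def)
    have "sqrt (T ^ 4) = T\<^sup>2"
      by (rule real_sqrt_unique) auto
    then have "sqrt (2 * R) = sqrt 2 * T\<^sup>2"
      by (simp add: R_def real_sqrt_mult)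
    then have "32 * sqrt (2 * R) * u 1 = (32 * sqrt 2 * u 1) * T\<^sup>2"
      by simp
    also have "\<dots> \<le> (\<epsilon> * \<gamma> * T) * T\<^sup>2"
      using T \<epsilon> \<gamma> by (intro mult_right_mono) (auto simp: field_simps)
    also have "\<dots> = \<epsilon> * (\<gamma> * R powr (3/4))"
    proof -
      have "R = T powr 4" using T by (simp add: R_def)
      then have "R powr (3/4) = T powr 3" by (simp only: powr_powr) simp
      also have "\<dots> = T ^ 3" using T by simp
      finally show ?thesis by (simp add: power2_eq_square power3_eq_cube)
    qed
    finally have far: "32 * sqrt (2 * R) * u 1 \<le> \<epsilon> * (\<gamma> * R powr (3/4))" .
    define K where "K = {a. cmod a \<le> R \<and> 0 \<le> Re (a * cnj n)}"
    have Ksub: "interior K \<subseteq> {a. 0 < Re (a * cnj n)}"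
      unfolding K_def using n by (intro interior_half_disc)
    show ?thesis
    proof (rule subharmonic_le_harmonic[where K = K and u = u and 
          F = "\<lambda>a. (cnj \<circ> (\<lambda>b. F (- (n\<^sup>2) * b)) \<circ> cnj) a + of_real \<epsilon> * p a"
          and h = "\<lambda>a. u (\<sigma> a) + \<epsilon> * Re (p a)"])
      have "closed K" unfolding K_def
        by (intro closed_Collect_conj closed_Collect_le continuous_intros)
      moreover have "bounded K" by (auto simp: K_def bounded_iff)
      ultimately show "compact K" by (simp add: compact_eq_bounded_closed)
      have "continuous_on K p"
        using holp by (intro holomorphic_on_imp_continuous_on) (auto simp: K_def elim: holomorphic_on_subset)
      moreover have "continuous_on K (\<lambda>a. u (\<sigma> a))"
        by (rule continuous_on_compose2[OF continuous]) (auto simp: \<sigma>_def intro!: continuous_intros)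
      ultimately show "continuous_on K (\<lambda>a. u (\<sigma> a) + \<epsilon> * Re (p a))"
        by (intro continuous_intros)
      show "(\<lambda>a. (cnj \<circ> (\<lambda>b. F (- (n\<^sup>2) * b)) \<circ> cnj) a + of_real \<epsilon> * p a) holomorphic_on interior K"
        using Ksub by (intro holomorphic_on_add holomorphic_on_mult holomorphic_on_const
            holomorphic_on_subset[OF hol] holomorphic_on_subset[OF holp]) auto
      show "u (\<sigma> a) + \<epsilon> * Re (p a) = Re ((cnj \<circ> (\<lambda>b. F (- (n\<^sup>2) * b)) \<circ> cnj) a + of_real \<epsilon> * p a)"
        if "a \<in> interior K" for a
        using Re_F[OF slit[of a]] that Ksub by (auto simp: \<sigma>_def)
      show "u a \<le> u (\<sigma> a) + \<epsilon> * Re (p a)" if a: "a \<in> K - interior K" for a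
      proof -
        have "open {a. cmod a < R \<and> 0 < Re (a * cnj n)}"
          by (intro open_Collect_conj open_Collect_less continuous_intros)
        then have "{a. cmod a < R \<and> 0 < Re (a * cnj n)} \<subseteq> interior K"
          by (intro interior_maximal) (auto simp: K_def)
        then have "\<not> (cmod a < R \<and> 0 < Re (a * cnj n))"
          using a by blast
        moreover have aK: "cmod a \<le> R" "0 \<le> Re (a * cnj n)" using a by (auto simp: K_def)
        ultimately consider "Re (a * cnj n) = 0" | "cmod a = R"
          by linarith
        then show ?thesis
        proof cases
          case 1
          then show ?thesis using fix\<sigma>[of a] p0[of a] \<epsilon> by simp
        next
          case 2
          have "u a \<le> 32 * sqrt (2 * R) * u 1"
            using growth_bound[of R a] 2 R by simp
          also note far
          also have "\<epsilon> * (\<gamma> * R powr (3/4)) \<le> \<epsilon> * Re (p a)"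
            using p[OF aK(2)] 2 \<epsilon> by (intro mult_left_mono) auto
          finally show ?thesis using nonneg[of "\<sigma> a"] by simp
        qed
      qed
      show "z \<in> K" using R z by (simp add: K_def)
    qed (use continuous sub_mean in auto)
  qed
  then have le: "u z \<le> u (\<sigma> z) + \<epsilon> * Re (p z)" if "0 < \<epsilon>" for \<epsilon>
    using that by blast
  have "u z \<le> u (\<sigma> z)"
  proof (rule field_le_epsilon)
    fix e :: real assume e: "0 < e"
    have "e / (Re (p z) + 1) * Re (p z) \<le> e"
      using e p0[OF z] by (simp add: field_simps)
    moreover have "0 < e / (Re (p z) + 1)"
      using e p0[OF z] by simp
    ultimately show "u z \<le> u (\<sigma> z) + e"
      using le by force
  qed
  then show ?thesis by (simp add: \<sigma>_def)
qed

text \<open>The unit normal \<open>(a - b) / |a - b|\<close> gives the line that interchanges \<open>a\<close> and \<open>b\<close>.\<close>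

lemma circle_mono_strict:
  assumes "cmod a = cmod b" "Re a < Re b"
  shows "u a \<le> u b"
proof -
  define d where "d = cmod (a - b)"
  have ab: "a \<noteq> b" using assms by auto
  then have d: "0 < d" by (simp add: d_def)
  define n where "n = (a - b) / of_real d"
  have n1: "cmod n = 1" using d by (simp add: n_def d_def norm_divide)
  have n2: "Re n < 0" using d assms by (simp add: n_def divide_neg_pos)
  have "Re (a * cnj b) \<le> cmod a * cmod b"
    using complex_Re_le_cmod[of "a * cnj b"] by (simp add: norm_mult)
  also have "\<dots> = Re (a * cnj a)"
    using assms by (simp add: complex_norm_square[symmetric] power2_eq_square)
  finally have "0 \<le> Re (a * cnj n)"
    using d by (simp add: n_def right_diff_distrib)
  note refl = reflection[OF n1 n2 this]
  have dd: "of_real d * of_real d = (a - b) * cnj (a - b)"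
    by (simp add: d_def complex_norm_square[symmetric] power2_eq_square del: complex_cnj_diff)
  have "- (n\<^sup>2) * cnj a = - ((a - b) * (a - b)) * cnj a / (of_real d * of_real d)"
    by (simp add: n_def power2_eq_square)
  also have "\<dots> = - (a - b) * cnj a / cnj (a - b)"
    unfolding dd using ab by (simp add: field_simps del: complex_cnj_diff)
  also have "- (a - b) * cnj a = b * cnj (a - b)"
    using assms(1) complex_norm_square[of a] complex_norm_square[of b]
    by (simp add: algebra_simps)
  finally have "- (n\<^sup>2) * cnj a = b" using ab by simp
  with refl show ?thesis by simp
qed

text \<open>For \<open>b = cnj a\<close> the mirror line is the real axis, where the cut lies on the line itself; this case is
a limit of points on the circle with smaller real part.\<close>

lemma circle_mono:
  assumes "cmod a = cmod b" "Re a \<le> Re b"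
  shows "u a \<le> u b"
proof (cases "a = b \<or> Re a < Re b")
  case True
  then show ?thesis using circle_mono_strict assms by auto
next
  case False
  define r x s where "r = cmod a" and "x = Re a" and "s = sgn (Im a)"
  have ReE: "Re a = Re b" using False assms by auto
  have r: "- r < x"
  proof (rule ccontr)
    assume "\<not> - r < x"
    then have x: "r = - x" using abs_Re_le_cmod[of a] by (simp add: r_def x_def)
    then have "(Im a)\<^sup>2 = 0" "(Im b)\<^sup>2 = 0"
      using cmod_power2[of a] cmod_power2[of b] assms ReE by (auto simp: r_def x_def)
    then show False using ReE False by (simp add: complex_eq_iff)
  qed
  have rx: "x \<le> r" using complex_Re_le_cmod by (simp add: r_def x_def)
  define w where "w = (\<lambda>t. Complex (x - t) (s * sqrt (r\<^sup>2 - (x - t)\<^sup>2)))"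
  have Im0: "Im a \<noteq> 0"
  proof
    assume "Im a = 0"
    then have "(Im b)\<^sup>2 = 0" using cmod_power2[of a] cmod_power2[of b] assms ReE by simp
    then show False using ReE False \<open>Im a = 0\<close> by (simp add: complex_eq_iff)
  qed
  have w0: "w 0 = a"
  proof -
    have "sqrt (r\<^sup>2 - x\<^sup>2) = \<bar>Im a\<bar>"
      using cmod_power2[of a] by (simp add: r_def x_def)
    then show ?thesis
      by (simp add: w_def s_def complex_eq_iff sgn_mult_abs) (simp add: x_def)
  qed
  have le: "u (w t) \<le> u b" if "0 < t" "t < r + x" for t
  proof (rule circle_mono_strict)
    have "(x - t)\<^sup>2 \<le> r\<^sup>2"
      using that rx by (intro abs_le_square_iff[THEN iffD1]) auto
    moreover have "s\<^sup>2 = 1" using Im0 by (simp add: s_def sgn_if)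
    ultimately have "(cmod (w t))\<^sup>2 = r\<^sup>2"
      by (simp add: cmod_power2 w_def power_mult_distrib)
    then show "cmod (w t) = cmod b"
      using assms by (metis norm_ge_zero power2_eq_iff_nonneg r_def)
    show "Re (w t) < Re b" using that ReE by (simp add: w_def x_def)
  qed
  have "continuous_on UNIV w"
    unfolding w_def Complex_eq by (intro continuous_intros)
  then have "continuous_on UNIV (\<lambda>t. u (w t))"
    by (rule continuous_on_compose2[OF continuous]) auto
  then have "((\<lambda>t. u (w t)) \<longlongrightarrow> u (w 0)) (at_right 0)"
    by (auto simp: continuous_on_def intro: tendsto_within_subset)
  moreover have "\<forall>\<^sub>F t in at_right 0. u (w t) \<le> u b"
    using le r unfolding eventually_at_right_field by (intro exI[of _ "r + x"]) auto
  ultimately show ?thesis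
    unfolding w0 by (intro tendsto_upperbound[of _ _ "at_right (0::real)"]) auto
qed

lemma le_positive_axis: "u z \<le> u (of_real (cmod z))"
  by (rule circle_mono) (auto simp: complex_Re_le_cmod)

lemma max_circle_eq: "0 < r \<Longrightarrow> max_circle r u = u (of_real r)"
  unfolding max_circle_def
  by (rule cSup_eq_maximum) (use le_positive_axis in \<open>auto intro!: image_eqI[of _ _ "of_real r"]\<close>)

lemma min_circle_eq: "0 < r \<Longrightarrow> min_circle r u = u (of_real (- r))"
  unfolding min_circle_def
proof (rule cInf_eq_minimum)
  assume r: "0 < r"
  show "u (of_real (- r)) \<in> u ` sphere 0 r"
    using r by (intro image_eqI[of _ _ "of_real (- r)"]) auto
  fix x assume "x \<in> u ` sphere 0 r"
  then obtain z where z: "x = u z" "cmod z = r" by auto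
  then show "u (of_real (- r)) \<le> x"
    using abs_Re_le_cmod[of z] r by (auto intro!: circle_mono)
qed

lemma antimono_angle:
  assumes "0 < r" shows "antimono_on {0..pi} (\<lambda>\<theta>. u (rcis r \<theta>))"
proof (rule monotone_onI)
  fix a b :: real assume "a \<in> {0..pi}" "b \<in> {0..pi}" "a \<le> b"
  then have "cos b \<le> cos a" by (intro cos_monotone_0_pi_le) auto
  then show "u (rcis r b) \<le> u (rcis r a)"
    using assms by (intro circle_mono) auto
qed

lemma growth_order_le: "growth_order u \<le> ereal (1/2)"
proof -
  have "u 1 > 0" by (rule pos) auto
  have "\<forall>\<^sub>F r in at_top. ereal (ln (max_circle r u) / ln r) \<le> ereal (1/2 + ln (u 1) / ln r)"
    using eventually_gt_at_top[of 1]
  proof eventually_elim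
    case (elim r)
    have ur: "0 < u (of_real r)" using elim by (intro pos) auto
    have "u (of_real r) \<le> sqrt r * u 1"
      using antimono_ratio[of 1 r] elim by (simp add: field_simps)
    then have "ln (u (of_real r)) \<le> ln (sqrt r * u 1)"
      using ur by (intro ln_mono) auto
    also have "\<dots> = ln r / 2 + ln (u 1)"
      using elim \<open>u 1 > 0\<close> by (simp add: ln_mult_pos ln_sqrt)
    finally show ?case
      using elim by (simp add: max_circle_eq field_simps)
  qed
  then have "growth_order u \<le> Limsup at_top (\<lambda>r. ereal (1/2 + ln (u 1) / ln r))"
    unfolding growth_order_def by (rule Limsup_mono)
  also have "((\<lambda>r. 1/2 + ln (u 1) / ln r) \<longlongrightarrow> 1/2) at_top"
    by real_asymp
  then have "Limsup at_top (\<lambda>r. ereal (1/2 + ln (u 1) / ln r)) = ereal (1/2)"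
    by (intro lim_imp_Limsup) auto
  finally show ?thesis .
qed

end

section \<open>A functional that grows along the zero set\<close>

lemma bounded_convex_nonneg_derivative:
  fixes y p p' :: "real \<Rightarrow> real"
  assumes y: "\<And>t. (y has_real_derivative p t) (at t)"
    and p: "\<And>t. (p has_real_derivative p' t) (at t)" and p': "\<And>t. 0 \<le> p' t"
    and bd: "\<And>t. t \<le> 0 \<Longrightarrow> y t \<le> C"
  shows "0 \<le> p t"
proof (rule ccontr)
  assume "\<not> 0 \<le> p t"
  then have neg: "0 < - p t" by simp
  have mono: "p s \<le> p t" if "s \<le> t" for s t
    using that p p' by (intro DERIV_nonneg_imp_nondecreasing[of s t p]) auto
  have low: "y t + (- p t) * (t - s) \<le> y s" if "s < t" for s
  proof -
    obtain x where x: "s < x" "x < t" "y t - y s = (t - s) * p x"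
      using MVT2[OF \<open>s < t\<close> y] by blast
    have "(t - s) * p x \<le> (t - s) * p t"
      using that x mono[of x t] by (intro mult_left_mono) auto
    with x show ?thesis by (simp add: algebra_simps)
  qed
  \<comment> \<open>Far enough to the left for the tangent line at \<open>t\<close>, which has negative slope, to exceed \<open>C\<close>.\<close>
  define s where "s = min 0 t - 1 - \<bar>C - y t\<bar> / (- p t)"
  have "0 \<le> \<bar>C - y t\<bar> / (- p t)"
    using neg by (intro divide_nonneg_pos) auto
  then have s: "s < t" "s \<le> 0"
    by (auto simp: s_def)
  have "\<bar>C - y t\<bar> / (- p t) < t - s" by (simp add: s_def min_def)
  then have "\<bar>C - y t\<bar> < (- p t) * (t - s)"
    using neg by (simp add: field_simps)
  then have "C < y t + (- p t) * (t - s)" by linarith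
  with low[OF s(1)] bd[OF s(2)] show False by simp
qed

lemma has_integral_cos:
  fixes \<beta> :: real
  assumes "0 < \<beta>" "0 \<le> a"
  shows "((\<lambda>\<theta>. cos (\<beta> * \<theta>)) has_integral 2 * sin (\<beta> * a) / \<beta>) {-a..a}"
proof -
  have "((\<lambda>\<theta>. cos (\<beta> * \<theta>)) has_integral sin (\<beta> * a) / \<beta> - sin (\<beta> * (- a)) / \<beta>) {-a..a}"
    using assms
    by (intro fundamental_theorem_of_calculus)
       (auto intro!: derivative_eq_intros simp flip: has_real_derivative_iff_has_vector_derivative)
  then show ?thesis by simp
qed

context slit_subharmonic
begin

lemma exp_strip_not_nonpos:
  assumes "\<bar>Im s\<bar> < pi" shows "exp s \<notin> \<real>\<^sub>\<le>\<^sub>0"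
proof
  assume "exp s \<in> \<real>\<^sub>\<le>\<^sub>0"
  then have e: "exp (Re s) * cos (Im s) \<le> 0" "sin (Im s) = 0"
    by (auto simp: complex_nonpos_Reals_iff Re_exp Im_exp)
  then have "Im s = 0" using assms sin_eq_0_pi by auto
  with e show False by (simp add: not_le)
qed

lemma strip_primitive:
  obtains P where "\<And>s. \<bar>Im s\<bar> < pi \<Longrightarrow> (P has_field_derivative F (exp s) * exp (of_real c * s)) (at s)"
proof -
  define S where "S = {s. \<bar>Im s\<bar> < pi}"
  have S: "S = {s. Im s < pi} \<inter> {s. Im s > - pi}" by (auto simp: S_def)
  have "convex S" "open S"
    unfolding S by (auto intro!: convex_Int convex_halfspace_Im_lt convex_halfspace_Im_gt
        open_Int open_halfspace_Im_lt open_halfspace_Im_gt)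
  moreover have "(F \<circ> exp) holomorphic_on S"
    by (rule holomorphic_on_compose_gen[OF _ holomorphic])
       (use exp_strip_not_nonpos in \<open>auto simp: S_def intro!: holomorphic_intros\<close>)
  then have "(\<lambda>s. F (exp s) * exp (of_real c * s)) holomorphic_on S"
    by (intro holomorphic_intros) (auto simp: o_def)
  ultimately obtain P where "\<And>s. s \<in> S \<Longrightarrow> (P has_field_derivative F (exp s) * exp (of_real c * s)) (at s within S)"
    using holomorphic_convex_primitive' by blast
  then show thesis
    using at_within_open[OF _ \<open>open S\<close>] by (intro that[of P]) (auto simp: S_def)
qed

text \<open>In the coordinate \<open>s = t + \<i> \<theta> = ln z\<close> the function \<open>u\<close> is the real part of \<open>F(exp s)\<close>.  Integration by
parts turns \<open>z = y' + \<beta> y\<close> into \<open>\<beta> e^(\<beta> t)\<close> times the imaginary part of the integral of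
\<open>F(exp s) exp(- \<beta> s)\<close> over a vertical segment, that is, of a difference of values of a primitive \<open>P\<close>
at \<open>t \<plusminus> \<i> b\<close>.  Defining \<open>z\<close> in this way, and \<open>y' - \<beta> y\<close> likewise with a primitive \<open>Q\<close> of
\<open>F(exp s) exp(\<beta> s)\<close>, makes all derivatives explicit and avoids differentiation under the integral.  At the
ends of the segment \<open>\<beta> b = \<pi>/2\<close>, so the exponentials are \<open>\<plusminus> \<i>\<close> and only values of \<open>u\<close> remain.\<close>

lemma cosine_transform:
  assumes \<beta>: "1/2 < \<beta>"
  obtains y z :: "real \<Rightarrow> real" where
    "\<And>t. ((\<lambda>\<theta>. u (rcis (exp t) \<theta>) * cos (\<beta> * \<theta>)) has_integral y t) {-(pi / (2*\<beta>))..pi / (2*\<beta>)}"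
    "\<And>t. (y has_real_derivative z t - \<beta> * y t) (at t)"
    "\<And>t. (z has_real_derivative \<beta> * (z t - 2 * u (rcis (exp t) (pi / (2*\<beta>))))) (at t)"
proof -
  define b where "b = pi / (2 * \<beta>)"
  have b: "0 < b" "b < pi" "\<beta> * b = pi / 2"
    using \<beta> by (auto simp: b_def field_simps)
  obtain P where P: "\<And>s. \<bar>Im s\<bar> < pi \<Longrightarrow> (P has_field_derivative F (exp s) * exp (of_real (- \<beta>) * s)) (at s)"
    using strip_primitive by blast
  obtain Q where Q: "\<And>s. \<bar>Im s\<bar> < pi \<Longrightarrow> (Q has_field_derivative F (exp s) * exp (of_real \<beta> * s)) (at s)"
    using strip_primitive by blast
  have exp_rcis: "exp (Complex t \<theta>) = rcis (exp t) \<theta>" for t \<theta>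
    by (simp add: rcis_def cis_conv_exp Complex_eq exp_add exp_of_real)
  have ReF: "Re (F (rcis (exp t) \<theta>)) = u (rcis (exp t) \<theta>)" if "\<bar>\<theta>\<bar> < pi" for t \<theta>
    using Re_F[OF exp_strip_not_nonpos[of "Complex t \<theta>"]] that by (simp add: exp_rcis)
  have expC: "exp (of_real c * Complex t \<theta>) = of_real (exp (c * t)) * cis (c * \<theta>)" for c t \<theta>
    by (simp add: cis_conv_exp Complex_eq exp_add ring_distribs mult_ac flip: exp_of_real)
  define A where "A = (\<lambda>t. u (rcis (exp t) b))"
  have A: "u (rcis (exp t) (- b)) = A t" for t
    unfolding A_def by (intro antisym circle_mono) auto
  have ReFb: "Re (F (rcis (exp t) b)) = A t" "Re (F (rcis (exp t) (- b))) = A t" for t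
    using ReF[of b t] ReF[of "- b" t] A[of t] b by (auto simp: A_def)
  have along: "((\<lambda>t. G (Complex t \<theta>)) has_vector_derivative g (Complex t \<theta>)) (at t)"
    if "\<And>s. \<bar>Im s\<bar> < pi \<Longrightarrow> (G has_field_derivative g s) (at s)" "\<bar>\<theta>\<bar> < pi" for G g t \<theta>
  proof -
    have "((\<lambda>t. Complex t \<theta>) has_vector_derivative 1) (at t)"
      unfolding Complex_eq by (auto intro!: derivative_eq_intros)
    from field_vector_diff_chain_at[OF this, of G "g (Complex t \<theta>)"] that show ?thesis
      by (simp add: o_def)
  qed
  have across: "((\<lambda>\<theta>. G (Complex t \<theta>)) has_vector_derivative \<i> * g (Complex t \<theta>)) (at \<theta>)"
    if "\<And>s. \<bar>Im s\<bar> < pi \<Longrightarrow> (G has_field_derivative g s) (at s)" "\<bar>\<theta>\<bar> < pi" for G g t \<theta>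
  proof -
    have "((\<lambda>\<theta>. Complex t \<theta>) has_vector_derivative \<i>) (at \<theta>)"
      unfolding Complex_eq by (auto intro!: derivative_eq_intros)
    from field_vector_diff_chain_at[OF this, of G "g (Complex t \<theta>)"] that show ?thesis
      by (simp add: o_def)
  qed
  have Im_deriv: "((\<lambda>t. Im (f t)) has_real_derivative Im f') (at t)"
    if "(f has_vector_derivative f') (at t)" for f f' and t :: real
    using bounded_linear.has_vector_derivative[OF bounded_linear_Im that]
    by (simp add: has_real_derivative_iff_has_vector_derivative)
  \<comment> \<open>The functions \<open>z\<close> and \<open>y\<close> below are combinations of \<open>p\<close> and \<open>q\<close>; note that \<open>y' - \<beta> y = - \<beta> e^(- \<beta> t) q\<close>.\<close>
  define p where "p = (\<lambda>t. Im (P (Complex t b)) - Im (P (Complex t (- b))))"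
  define q where "q = (\<lambda>t. Im (Q (Complex t b)) - Im (Q (Complex t (- b))))"
  have p': "(p has_real_derivative - exp (- \<beta> * t) * (2 * A t)) (at t)" for t
  proof -
    have "(p has_real_derivative
        Im (F (exp (Complex t b)) * exp (of_real (- \<beta>) * Complex t b))
      - Im (F (exp (Complex t (-b))) * exp (of_real (- \<beta>) * Complex t (-b)))) (at t)"
      unfolding p_def using b by (intro DERIV_diff Im_deriv along[OF P]) auto
    then show ?thesis
      unfolding expC exp_rcis using b(3) by (simp add: ReFb algebra_simps)
  qed
  have q': "(q has_real_derivative exp (\<beta> * t) * (2 * A t)) (at t)" for t
  proof -
    have "(q has_real_derivative
        Im (F (exp (Complex t b)) * exp (of_real \<beta> * Complex t b))
      - Im (F (exp (Complex t (-b))) * exp (of_real \<beta> * Complex t (-b)))) (at t)"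
      unfolding q_def using b by (intro DERIV_diff Im_deriv along[OF Q]) auto
    then show ?thesis
      unfolding expC exp_rcis using b(3) by (simp add: ReFb algebra_simps)
  qed
  define z where "z = (\<lambda>t. \<beta> * exp (\<beta> * t) * p t)"
  define y where "y = (\<lambda>t. (exp (\<beta> * t) * p t + exp (- \<beta> * t) * q t) / 2)"
  have ee: "exp (\<beta> * t) * exp (- \<beta> * t) = 1" for t
    by (simp flip: exp_add)
  have e: "((\<lambda>t. exp (c * t)) has_real_derivative c * exp (c * t)) (at t)" for c t
    by (auto intro!: derivative_eq_intros)
  have z': "(z has_real_derivative \<beta> * (z t - 2 * A t)) (at t)" for t
    unfolding z_def mult.assoc
    by (rule DERIV_cong[OF DERIV_cmult[OF DERIV_mult[OF e p']]]) (simp add: exp_minus field_simps)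
  have y': "(y has_real_derivative z t - \<beta> * y t) (at t)" for t
    unfolding y_def z_def
    by (rule DERIV_cong[OF DERIV_cdivide[OF DERIV_add[OF DERIV_mult[OF e p'] DERIV_mult[OF e q']]]])
       (simp add: exp_minus field_simps)
  have int: "((\<lambda>\<theta>. u (rcis (exp t) \<theta>) * cos (\<beta> * \<theta>)) has_integral y t) {-b..b}" for t
  proof -
    define Y where "Y = (\<lambda>\<theta>. (exp (\<beta> * t) * Im (P (Complex t \<theta>)) + exp (- \<beta> * t) * Im (Q (Complex t \<theta>))) / 2)"
    have "(Y has_real_derivative u (rcis (exp t) \<theta>) * cos (\<beta> * \<theta>)) (at \<theta>)" if \<theta>: "\<bar>\<theta>\<bar> < pi" for \<theta>
    proof -
      have "(Y has_real_derivative 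
         (exp (\<beta> * t) * Im (\<i> * (F (exp (Complex t \<theta>)) * exp (of_real (- \<beta>) * Complex t \<theta>)))
        + exp (- \<beta> * t) * Im (\<i> * (F (exp (Complex t \<theta>)) * exp (of_real \<beta> * Complex t \<theta>)))) / 2) (at \<theta>)"
        unfolding Y_def using \<theta>
        by (intro DERIV_cdivide DERIV_add DERIV_cmult Im_deriv across[OF P] across[OF Q]) auto
      also have "exp (\<beta> * t) * Im (\<i> * (F (exp (Complex t \<theta>)) * exp (of_real (- \<beta>) * Complex t \<theta>)))
        + exp (- \<beta> * t) * Im (\<i> * (F (exp (Complex t \<theta>)) * exp (of_real \<beta> * Complex t \<theta>)))
        = (exp (\<beta> * t) * exp (- \<beta> * t)) * (2 * (u (rcis (exp t) \<theta>) * cos (\<beta> * \<theta>)))"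
        unfolding expC exp_rcis ReF[OF \<theta>, symmetric] by (simp add: algebra_simps)
      finally show ?thesis unfolding ee by simp
    qed
    note Y' = this
    have "((\<lambda>\<theta>. u (rcis (exp t) \<theta>) * cos (\<beta> * \<theta>)) has_integral Y b - Y (- b)) {-b..b}"
    proof (rule fundamental_theorem_of_calculus)
      show "(Y has_vector_derivative u (rcis (exp t) \<theta>) * cos (\<beta> * \<theta>)) (at \<theta> within {-b..b})"
        if "\<theta> \<in> {-b..b}" for \<theta>
      proof -
        have "\<bar>\<theta>\<bar> < pi" using that b by auto
        from has_field_derivative_at_within[OF Y'[OF this]] show ?thesis
          by (simp add: has_real_derivative_iff_has_vector_derivative)
      qed
    qed (use b in auto)
    also have "Y b - Y (- b) = y t"
      by (simp add: Y_def y_def p_def q_def algebra_simps diff_divide_distrib add_divide_distrib)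
    finally show ?thesis .
  qed
  show thesis
    using int y' z' unfolding A_def b_def by (intro that[of y z])
qed

text \<open>The constants do not depend on \<open>\<beta>\<close>, which allows \<open>\<beta>\<close> to tend to \<open>1/2\<close> later.  The lower bound on \<open>z\<close>
makes it nondecreasing.  The upper bound comes from convexity: \<open>y'(t)\<close> is at most the increment of \<open>y\<close>
over \<open>[t, t + 1]\<close>, whence the factor \<open>sqrt e\<close>.\<close>

lemma growth_functional:
  assumes \<beta>: "1/2 < \<beta>" "\<beta> < 1"
  obtains z :: "real \<Rightarrow> real" where
    "\<And>t. (z has_real_derivative \<beta> * (z t - 2 * u (rcis (exp t) (pi / (2*\<beta>))))) (at t)"
    "\<And>t. 2 * u (rcis (exp t) (pi / (2*\<beta>))) \<le> z t"
    "u \<i> \<le> z 0" "\<And>t. z t \<le> 4 * sqrt (exp 1) * u (of_real (exp t))"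
proof -
  define b where "b = pi / (2 * \<beta>)"
  have b: "pi / 2 < b" "b < pi" "\<beta> * b = pi / 2"
    using \<beta> by (auto simp: b_def field_simps)
  define A where "A = (\<lambda>t. u (rcis (exp t) b))"
  obtain y z where int: "\<And>t. ((\<lambda>\<theta>. u (rcis (exp t) \<theta>) * cos (\<beta> * \<theta>)) has_integral y t) {-b..b}"
    and y': "\<And>t. (y has_real_derivative z t - \<beta> * y t) (at t)"
    and z': "\<And>t. (z has_real_derivative \<beta> * (z t - 2 * A t)) (at t)"
    using cosine_transform[OF \<beta>(1)] unfolding A_def b_def by blast
  have cos_int: "((\<lambda>\<theta>. c * cos (\<beta> * \<theta>)) has_integral c * (2 / \<beta>)) {-b..b}" for c
    using has_integral_mult_right[OF has_integral_cos[of \<beta> b], of c] \<beta> b by simp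
  have cos_pos: "0 \<le> cos (\<beta> * \<theta>)" if "\<theta> \<in> {-b..b}" for \<theta>
  proof (rule cos_ge_zero)
    have "\<beta> * \<theta> \<le> \<beta> * b" "\<beta> * (- b) \<le> \<beta> * \<theta>"
      using that \<beta> mult_left_mono[of \<theta> b \<beta>] mult_left_mono[of "- b" \<theta> \<beta>] by auto
    then show "- (pi / 2) \<le> \<beta> * \<theta>" "\<beta> * \<theta> \<le> pi / 2" using b by auto
  qed
  have yA: "A t * (2 / \<beta>) \<le> y t" for t
  proof (rule has_integral_le[OF cos_int int])
    fix \<theta> assume \<theta>: "\<theta> \<in> {-b..b}"
    have "cos b \<le> cos \<bar>\<theta>\<bar>" using \<theta> b by (intro cos_monotone_0_pi_le) auto
    then have "A t \<le> u (rcis (exp t) \<theta>)"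
      unfolding A_def by (intro circle_mono) auto
    then show "A t * cos (\<beta> * \<theta>) \<le> u (rcis (exp t) \<theta>) * cos (\<beta> * \<theta>)"
      using cos_pos[OF \<theta>] by (rule mult_right_mono)
  qed
  have yB: "y t \<le> u (of_real (exp t)) * (2 / \<beta>)" for t
    using cos_pos le_positive_axis[of "rcis (exp t) _"]
    by (intro has_integral_le[OF int cos_int] mult_right_mono) auto
  have y0: "0 \<le> y t" for t
    using \<beta> nonneg by (intro order_trans[OF _ yA]) (auto simp: A_def)
  \<comment> \<open>On the right half of the circle \<open>u \<ge> u \<i>\<close>, and \<open>cos (\<beta> \<theta>) \<ge> cos \<theta>\<close>; the left half contributes a nonnegative amount.\<close>
  have y_zero: "2 * u \<i> \<le> y 0"
  proof -
    have "((\<lambda>\<theta>. u (rcis (exp 0) \<theta>) * cos (\<beta> * \<theta>)) has_integral integral {-(pi/2)..pi/2} (\<lambda>\<theta>. u (rcis (exp 0) \<theta>) * cos (\<beta> * \<theta>))) {-(pi/2)..pi/2}"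
      using integrable_on_subinterval[OF has_integral_integrable[OF int[of 0]], of "-(pi/2)" "pi/2"] b
      by (auto intro!: integrable_integral)
    note half = this
    have "u \<i> * 2 \<le> integral {-(pi/2)..pi/2} (\<lambda>\<theta>. u (rcis (exp 0) \<theta>) * cos (\<beta> * \<theta>))"
    proof (rule has_integral_le[OF _ half])
      show "((\<lambda>\<theta>. u \<i> * cos \<theta>) has_integral u \<i> * 2) {-(pi/2)..pi/2}"
        using has_integral_mult_right[OF has_integral_cos[of 1 "pi/2"], of "u \<i>"] by simp
      fix \<theta> :: real assume \<theta>: "\<theta> \<in> {-(pi/2)..pi/2}"
      then have c0: "0 \<le> cos \<theta>" by (intro cos_ge_zero) auto
      have "u \<i> \<le> u (rcis (exp 0) \<theta>)"
        using c0 by (intro circle_mono) auto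
      moreover have "cos \<bar>\<theta>\<bar> \<le> cos \<bar>\<beta> * \<theta>\<bar>"
        using \<theta> \<beta> mult_right_mono[of \<beta> 1 "\<bar>\<theta>\<bar>"] by (intro cos_monotone_0_pi_le) (auto simp: abs_mult)
      ultimately show "u \<i> * cos \<theta> \<le> u (rcis (exp 0) \<theta>) * cos (\<beta> * \<theta>)"
        using c0 nonneg unfolding cos_abs_real by (intro mult_mono) auto
    qed
    also have "\<dots> \<le> y 0"
      using cos_pos nonneg b by (intro has_integral_subset_le[OF _ half int]) auto
    finally show ?thesis by simp
  qed
  \<comment> \<open>This is \<open>y'\<close>, and its derivative is \<open>y'' = \<beta>\<^sup>2 y - 2 \<beta> A\<close>.\<close>
  define p where "p = (\<lambda>t. z t - \<beta> * y t)"
  have p': "(p has_real_derivative \<beta> * (\<beta> * y t - 2 * A t)) (at t)" for t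
    unfolding p_def by (auto intro!: derivative_eq_intros z' y' simp: algebra_simps)
  have convex: "0 \<le> \<beta> * (\<beta> * y t - 2 * A t)" for t
    using yA[of t] \<beta> by (simp add: field_simps)
  have p0: "0 \<le> p t" for t
  proof (rule bounded_convex_nonneg_derivative[of y p])
    fix t :: real assume "t \<le> 0"
    have "u (of_real (exp t)) \<le> 32 * u (of_real 2)"
      using \<open>t \<le> 0\<close> by (intro growth_doubling) (auto simp: norm_exp_eq_Re simp flip: exp_of_real)
    then show "y t \<le> 32 * u (of_real 2) * (2 / \<beta>)"
      using yB[of t] \<beta> by (smt (verit) divide_nonneg_nonneg mult_right_mono)
  qed (use y' p' convex in \<open>auto simp: p_def\<close>)
  have "z t \<le> 4 * sqrt (exp 1) * u (of_real (exp t))" for t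
  proof -
    obtain x where x: "t < x" "x < t + 1" "y (t + 1) - y t = (t + 1 - t) * p x"
      using MVT2[of t "t + 1" y p] y' by (auto simp: p_def)
    have "p t \<le> p x"
      using x p' convex by (intro DERIV_nonneg_imp_nondecreasing[of t x p]) auto
    then have "z t \<le> y (t + 1) - (1 - \<beta>) * y t"
      using x by (simp add: p_def algebra_simps)
    also have "\<dots> \<le> y (t + 1)" using y0[of t] \<beta> by simp
    also have "\<dots> \<le> u (of_real (exp (t + 1))) * (2 / \<beta>)" by (rule yB)
    also have "\<dots> \<le> u (of_real (exp (t + 1))) * 4"
      using \<beta> nonneg by (intro mult_left_mono) (auto simp: field_simps)
    also have "u (of_real (exp (t + 1))) \<le> sqrt (exp 1) * u (of_real (exp t))"
      using antimono_ratio[of "exp t" "exp (t + 1)"] by (simp add: exp_add real_sqrt_mult field_simps)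
    finally show ?thesis by (simp add: mult_ac)
  qed
  moreover have "2 * A t \<le> z t" for t
    using p0[of t] yA[of t] \<beta> by (simp add: p_def field_simps)
  moreover have "u \<i> \<le> z 0"
  proof -
    have "\<beta> * (2 * u \<i>) \<le> \<beta> * y 0" using y_zero \<beta> by (intro mult_left_mono) auto
    moreover have "1 * u \<i> \<le> (2 * \<beta>) * u \<i>" using \<beta> nonneg by (intro mult_right_mono) auto
    ultimately show ?thesis using p0[of 0] by (simp add: p_def)
  qed
  ultimately show thesis
    using z' unfolding A_def b_def by (intro that[of z])
qed

section \<open>Logarithmic density of the zero set\<close>

text \<open>The logarithmic derivative of the growth functional is nonnegative, and on \<open>S\<close> it is close to
\<open>1/2\<close> when \<open>\<beta>\<close> is close to \<open>1/2\<close>, by uniform continuity of \<open>u\<close> near the cut.  The factor \<open>k < 1\<close>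
in the proof absorbs this error.\<close>

lemma log_growth:
  assumes S: "S \<in> sets borel" and zero: "\<And>x. x \<in> S \<Longrightarrow> 0 < x \<Longrightarrow> u (of_real (- x)) = 0"
    and r: "1 < r"
  shows "1/2 * (LINT t:S \<inter> {1<..<r}|lborel. 1 / t)
    \<le> ln (u (of_real r)) + (ln (4 * sqrt (exp 1)) - ln (u \<i>))"
proof -
  define I where "I = (LINT t:S \<inter> {1<..<r}|lborel. 1 / t)"
  have "set_integrable lborel {1..r} (\<lambda>t::real. 1 / t)"
    by (intro borel_integrable_atLeastAtMost' continuous_intros) auto
  then have "set_integrable lborel (S \<inter> {1<..<r}) (\<lambda>t. 1 / t)"
    by (rule set_integrable_subset) (use S in auto)
  from set_borel_integral_eq_integral[OF this]
  have hasI: "((\<lambda>t. 1 / t) has_integral I) (S \<inter> {1<..<r})"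
    by (simp add: I_def integrable_integral)
  have ui: "0 < u \<i>" by (rule pos) (auto simp: complex_nonpos_Reals_iff)
  have "k * (1/2 * I) \<le> ln (u (of_real r)) + (ln (4 * sqrt (exp 1)) - ln (u \<i>))"
    if k: "0 < k" "k < 1" for k
  proof -
    \<comment> \<open>If \<open>A \<le> \<eta>\<close> and \<open>z \<ge> u \<i>\<close>, then \<open>1 - 2 A / z \<ge> k\<close>.\<close>
    define \<eta> where "\<eta> = (1 - k) * u \<i> / 2"
    have \<eta>: "0 < \<eta>" using k ui by (simp add: \<eta>_def)
    have "uniformly_continuous_on (cball 0 r) u"
      by (intro compact_uniformly_continuous continuous_on_subset[OF continuous]) auto
    then obtain \<delta> where \<delta>: "0 < \<delta>"
      "\<And>a b. a \<in> cball 0 r \<Longrightarrow> b \<in> cball 0 r \<Longrightarrow> dist b a < \<delta> \<Longrightarrow> dist (u b) (u a) < \<eta>"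
      using \<eta> unfolding uniformly_continuous_on_def by metis
    have "((\<lambda>\<beta>. r * cmod (cis (pi / (2 * \<beta>)) + 1)) \<longlongrightarrow> r * cmod (cis (pi / (2 * (1/2))) + 1)) (at_right (1/2))"
      by (intro tendsto_intros) auto
    then have "((\<lambda>\<beta>. r * cmod (cis (pi / (2 * \<beta>)) + 1)) \<longlongrightarrow> 0) (at_right (1/2))"
      by simp
    then have "\<forall>\<^sub>F \<beta> in at_right (1/2). r * cmod (cis (pi / (2 * \<beta>)) + 1) < \<delta>"
      using \<delta>(1) by (rule order_tendstoD)
    moreover have "\<forall>\<^sub>F \<beta> in at_right (1/2). \<beta> \<in> {1/2<..<1::real}"
      by (rule eventually_at_right_real) simp
    ultimately have "\<forall>\<^sub>F \<beta> in at_right (1/2). r * cmod (cis (pi / (2 * \<beta>)) + 1) < \<delta> \<and> \<beta> \<in> {1/2<..<1::real}"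
      by (rule eventually_conj)
    then obtain \<beta> where \<beta>: "r * cmod (cis (pi / (2 * \<beta>)) + 1) < \<delta>" "1/2 < \<beta>" "\<beta> < 1"
      using eventually_happens'[of "at_right (1/2::real)"] by auto
    define A where "A = (\<lambda>t. u (rcis (exp t) (pi / (2 * \<beta>))))"
    obtain z where z': "\<And>t. (z has_real_derivative \<beta> * (z t - 2 * A t)) (at t)"
      and zA: "\<And>t. 2 * A t \<le> z t" and z0: "u \<i> \<le> z 0"
      and zu: "\<And>t. z t \<le> 4 * sqrt (exp 1) * u (of_real (exp t))"
      using growth_functional[OF \<beta>(2,3)] unfolding A_def by blast
    have zmono: "u \<i> \<le> z t" if "0 \<le> t" for t
    proof -
      have "z 0 \<le> z t"
        using that z' zA \<beta> by (intro DERIV_nonneg_imp_nondecreasing[of 0 t z]) (auto intro!: exI)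
      with z0 show ?thesis by simp
    qed
    \<comment> \<open>The derivative of \<open>ln (z (ln x))\<close>.\<close>
    define L where "L = (\<lambda>x. \<beta> * (z (ln x) - 2 * A (ln x)) / z (ln x) * (1 / x))"
    have L: "(L has_integral ln (z (ln r)) - ln (z (ln 1))) {1..r}"
    proof (rule fundamental_theorem_of_calculus)
      show "((\<lambda>x. ln (z (ln x))) has_vector_derivative L x) (at x within {1..r})"
        if x: "x \<in> {1..r}" for x
      proof -
        have "0 < z (ln x)" using zmono[of "ln x"] x ui by simp
        then have "((\<lambda>x. ln (z (ln x))) has_real_derivative 1 / z (ln x) * (\<beta> * (z (ln x) - 2 * A (ln x)) * (1 / x))) (at x)"
          using x by (intro DERIV_chain2[OF DERIV_ln_divide] DERIV_chain2[OF z'] DERIV_ln_divide) auto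
        from has_field_derivative_at_within[OF this] show ?thesis
          by (simp add: L_def has_real_derivative_iff_has_vector_derivative mult_ac)
      qed
    qed (use r in simp)
    have "((\<lambda>x. if x \<in> S \<inter> {1<..<r} then (k * (1/2)) * (1 / x) else 0) has_integral (k * (1/2)) * I) {1..r}"
      using has_integral_mult_right[OF hasI, of "k * (1/2)"] by (subst has_integral_restrict) auto
    then have "k * (1/2) * I \<le> ln (z (ln r)) - ln (z (ln 1))"
    proof (rule has_integral_le[OF _ L])
      fix x assume x: "x \<in> {1..r}"
      have zp: "0 < z (ln x)" "u \<i> \<le> z (ln x)" using zmono[of "ln x"] x ui by auto
      have L0: "0 \<le> L x" using zA[of "ln x"] zp x \<beta> by (simp add: L_def)
      show "(if x \<in> S \<inter> {1<..<r} then k * (1/2) * (1 / x) else 0) \<le> L x"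
      proof (cases "x \<in> S \<inter> {1<..<r}")
        case True
        have "dist (rcis x (pi / (2 * \<beta>))) (of_real (- x)) = x * cmod (cis (pi / (2 * \<beta>)) + 1)"
          using x by (simp add: dist_norm rcis_def norm_mult flip: distrib_left[of "of_real x" _ 1, simplified])
        also have "\<dots> \<le> r * cmod (cis (pi / (2 * \<beta>)) + 1)"
          using x by (intro mult_right_mono) auto
        finally have "dist (u (rcis x (pi / (2 * \<beta>)))) (u (of_real (- x))) < \<eta>"
          using x \<beta>(1) by (intro \<delta>(2)) auto
        then have "u (rcis x (pi / (2 * \<beta>))) < \<eta>"
          using zero[of x] True nonneg[of "rcis x (pi / (2 * \<beta>))"] by (simp add: dist_real_def)
        then have "2 * A (ln x) \<le> (1 - k) * u \<i>"
          using x by (simp add: A_def \<eta>_def)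
        also have "\<dots> \<le> (1 - k) * z (ln x)"
          using zp k by (intro mult_left_mono) auto
        finally have "k * z (ln x) \<le> z (ln x) - 2 * A (ln x)"
          by (simp add: algebra_simps)
        then have "(1/2) * (k * z (ln x)) \<le> \<beta> * (z (ln x) - 2 * A (ln x))"
          using \<beta> zp k by (intro mult_mono) auto
        then have "k * (1/2) \<le> \<beta> * (z (ln x) - 2 * A (ln x)) / z (ln x)"
          using zp by (simp add: pos_le_divide_eq mult_ac)
        then have "k * (1/2) * (1 / x) \<le> L x"
          unfolding L_def using x by (intro mult_right_mono) auto
        with True show ?thesis by simp
      qed (use L0 in auto)
    qed
    moreover have "ln (z (ln r)) \<le> ln (4 * sqrt (exp 1) * u (of_real r))"
      using zu[of "ln r"] zmono[of "ln r"] r ui by (intro ln_mono) auto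
    moreover have "ln (4 * sqrt (exp 1) * u (of_real r)) = ln (4 * sqrt (exp 1)) + ln (u (of_real r))"
      using r pos[of "of_real r"] by (intro ln_mult_pos) auto
    moreover have "ln (u \<i>) \<le> ln (z (ln 1))"
      using z0 ui by (intro ln_mono) auto
    ultimately show ?thesis by simp
  qed
  then have "1/2 * I \<le> ln (u (of_real r)) + (ln (4 * sqrt (exp 1)) - ln (u \<i>))"
    by (rule field_le_mult_one_interval)
  then show ?thesis by (simp add: I_def)
qed

lemma density_le_growth:
  assumes S: "S \<in> sets borel" and zero: "\<And>x. x \<in> S \<Longrightarrow> 0 < x \<Longrightarrow> u (of_real (- x)) = 0"
    and \<epsilon>: "0 < \<epsilon>"
  shows "\<forall>\<^sub>F r in at_top. ereal (1/2) * ereal (1 / ln r * (LINT t:S \<inter> {1<..<r}|lborel. 1 / t))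
    \<le> ereal (ln (max_circle r u) / ln r) + ereal \<epsilon>"
proof -
  define C where "C = ln (4 * sqrt (exp 1)) - ln (u \<i>)"
  have "((\<lambda>r. C / ln r) \<longlongrightarrow> 0) at_top" by real_asymp
  then have "\<forall>\<^sub>F r in at_top. C / ln r < \<epsilon>" using \<epsilon> by (rule order_tendstoD)
  then show ?thesis using eventually_gt_at_top[of 1]
  proof eventually_elim
    case (elim r)
    have l: "0 < ln r" using elim by simp
    define I where "I = (LINT t:S \<inter> {1<..<r}|lborel. 1 / t)"
    have "1/2 * I \<le> ln (u (of_real r)) + C"
      unfolding I_def C_def using S zero elim by (intro log_growth) auto
    then have "(1/2 * I) / ln r \<le> (ln (u (of_real r)) + C) / ln r"
      using l by (intro divide_right_mono) auto
    also have "\<dots> \<le> ln (u (of_real r)) / ln r + \<epsilon>"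
      using elim by (simp add: add_divide_distrib)
    finally show ?case
      using elim by (simp add: max_circle_eq I_def[symmetric])
  qed
qed

end

theorem theorem1p2:
  fixes u :: "complex \<Rightarrow> real" and E :: "complex set"
  assumes "class_K u E"
  shows "(\<forall>r>0. antimono_on {0..pi} (\<lambda>\<theta>. u (rcis r \<theta>))) \<and>
         (\<forall>r>0. max_circle r u = u (of_real r) \<and> min_circle r u = u (of_real (- r))) \<and>
         (\<forall>r>0. u (of_real r) / r powr (1/2) = max_circle r u / r powr (1/2)) \<and>
         antimono_on {0<..} (\<lambda>r. u (of_real r) / r powr (1/2)) \<and>
         growth_order u \<le> ereal (1/2) \<and>
         growth_order u \<ge> ereal (1/2) * upper_log_density (cmod ` E) \<and>
         lower_growth_order u \<ge> ereal (1/2) * lower_log_density (cmod ` E)"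
proof -
  obtain F where "slit_subharmonic u F"
    using class_K_slit_subharmonic[OF assms] .
  then interpret slit_subharmonic u F .
  have E: "closed E" "E \<subseteq> \<real>\<^sub>\<le>\<^sub>0" "\<And>z. z \<in> E \<Longrightarrow> u z = 0"
    using assms by (auto simp: class_K_def)
  have E_eq: "z = of_real (- cmod z)" if "z \<in> E" for z
  proof -
    have "z \<in> \<real>\<^sub>\<le>\<^sub>0" using that E(2) by blast
    then show ?thesis by (elim nonpos_Reals_cases) simp
  qed
  have mem: "x \<in> cmod ` E \<longleftrightarrow> 0 \<le> x \<and> of_real (- x) \<in> E" for x
  proof
    assume "x \<in> cmod ` E"
    then obtain z where z: "z \<in> E" "x = cmod z" by blast
    then show "0 \<le> x \<and> of_real (- x) \<in> E" using E_eq[OF z(1)] by simp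
  next
    assume x: "0 \<le> x \<and> of_real (- x) \<in> E"
    then show "x \<in> cmod ` E" by (intro image_eqI[of _ _ "of_real (- x)"]) auto
  qed
  then have zero: "u (of_real (- x)) = 0" if "x \<in> cmod ` E" for x
    using that E(3) by blast
  have "cmod ` E = {0..} \<inter> (\<lambda>x. of_real (- x)) -` E"
    using mem by auto
  moreover have "closed ((\<lambda>x::real. of_real (- x) :: complex) -` E)"
    by (intro closed_vimage E continuous_intros)
  ultimately have S: "cmod ` E \<in> sets borel"
    by (simp add: closed_Int borel_closed)
  have "ereal (1/2) * upper_log_density (cmod ` E) \<le> growth_order u + ereal \<epsilon>" if \<epsilon>: "0 < \<epsilon>" for \<epsilon>
  proof -
    have "ereal (1/2) * upper_log_density (cmod ` E)
      = Limsup at_top (\<lambda>r. ereal (1/2) * ereal (1 / ln r * (LINT t:cmod ` E \<inter> {1<..<r}|lborel. 1 / t)))"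
      unfolding upper_log_density_def by (rule Limsup_ereal_mult_left[symmetric]) auto
    also have "\<dots> \<le> Limsup at_top (\<lambda>r. ereal (ln (max_circle r u) / ln r) + ereal \<epsilon>)"
      by (rule Limsup_mono, rule density_le_growth[OF S zero \<epsilon>])
    also have "\<dots> = growth_order u + ereal \<epsilon>"
      unfolding growth_order_def by (rule Limsup_add_ereal_right) auto
    finally show ?thesis .
  qed
  then have up: "ereal (1/2) * upper_log_density (cmod ` E) \<le> growth_order u"
    by (rule ereal_le_epsilon2)
  have "ereal (1/2) * lower_log_density (cmod ` E) \<le> lower_growth_order u + ereal \<epsilon>" if \<epsilon>: "0 < \<epsilon>" for \<epsilon>
  proof -
    have "ereal (1/2) * lower_log_density (cmod ` E)
      = Liminf at_top (\<lambda>r. ereal (1/2) * ereal (1 / ln r * (LINT t:cmod ` E \<inter> {1<..<r}|lborel. 1 / t)))"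
      unfolding lower_log_density_def by (rule Liminf_ereal_mult_left[symmetric]) auto
    also have "\<dots> \<le> Liminf at_top (\<lambda>r. ereal (ln (max_circle r u) / ln r) + ereal \<epsilon>)"
      by (rule Liminf_mono, rule density_le_growth[OF S zero \<epsilon>])
    also have "\<dots> = lower_growth_order u + ereal \<epsilon>"
      unfolding lower_growth_order_def by (rule Liminf_add_ereal_right) auto
    finally show ?thesis .
  qed
  then have low: "ereal (1/2) * lower_log_density (cmod ` E) \<le> lower_growth_order u"
    by (rule ereal_le_epsilon2)
  have "antimono_on {0<..} (\<lambda>r. u (of_real r) / r powr (1/2))"
  proof (rule monotone_onI)
    fix r s :: real assume "r \<in> {0<..}" "s \<in> {0<..}" "r \<le> s"
    then show "u (of_real s) / s powr (1/2) \<le> u (of_real r) / r powr (1/2)"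
      using antimono_ratio[of r s] by (simp add: powr_half_sqrt)
  qed
  then show ?thesis
    using up low growth_order_le
    by (intro conjI allI impI antimono_angle max_circle_eq min_circle_eq) (simp_all only: max_circle_eq)
qed

end
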